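(* Let $r\ge1$ and let $\{\xi_i\}_{i=1}^{r+1}\subset[0,1]$ be pairwise distinct points with $\xi_1=0$ and $\xi_{r+1}=1$. Let $f_r^\xi:[-\pi,\pi]\to\mathbb{C}^{r\times r}$ be the associated symbol and let $A_n$ be the (normalized) stiffness matrix, of size $nr-1$, of the one-dimensional Laplacian with homogeneous Dirichlet conditions on a uniform mesh of $n$ elements with the basis associated with $\{\xi_i\}$. Then, as $n\to\infty$: 1. the minimal eigenvalue of $A_n$ goes to zero as $n^{-2}$, i.e. there are constants $c,C>0$ independent of $n$ with $c\,n^{-2}\le\lambda_{\min}(A_n)\le C\,n^{-2}$ for all sufficiently large $n$; 2. the maximal eigenvalue of $A_n$ converges from below to $\max_{\theta\in[-\pi,\pi]}\lambda_{\max}(f_r^\xi(\theta))$; 3. consequently the spectral condition number $\kappa_2(A_n)$ grows asymptotically exactly as $n^2$, i.e. there are constants $c',C'>0$ independent of $n$ with $c'n^2\le\kappa_2(A_n)\le C'n^2$ for all sufficiently large $n$.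
   Context: Let $\{\varphi_i\}_{i=1}^{r+1}$ be the basis of $\mathbb{P}_r$ (real univariate polynomials of degree at most $r$) determined by $\varphi_j(\xi_i)=\delta_{i,j}$, and let $A^{\mathrm{loc}}_{i,j}=\int_0^1\varphi_i'(x)\varphi_j'(x)\,\mathrm{d}x$, $i,j=1,\ldots,r+1$. Stiffness matrix: with the local-to-global map $\mathrm{LTG}(i,k)=(k-1)r+i$, $i=1,\ldots,r+1$, $k=1,\ldots,n$, assemble the $(nr+1)\times(nr+1)$ matrix obtained by adding $A^{\mathrm{loc}}_{i,j}$ to the entry $(\mathrm{LTG}(i,k),\mathrm{LTG}(j,k))$ for all $i,j,k$; $A_n$ is obtained from it by deleting the first and the last row and column (homogeneous Dirichlet conditions). Symbol: define $A_\xi\in\mathbb{R}^{(r+1)\times(r+1)}$ by $(A_\xi)_{i,j}=A^{\mathrm{loc}}_{1,1}+A^{\mathrm{loc}}_{r+1,r+1}$ if $(i,j)=(1,1)$ or $(r+1,r+1)$, and $(A_\xi)_{i,j}=A^{\mathrm{loc}}_{i,j}$ otherwise. Let $\alpha_\xi$ be the leading $r\times r$ block of $A_\xi$, let $\widetilde\beta_\xi\in\mathbb{R}^{1\times r}$ be the first $r$ entries of the last row of $A_\xi$, and let $\beta_\xi\in\mathbb{R}^{r\times r}$ have first row $\widetilde\beta_\xi$ and all other rows zero. Then $f_r^\xi(\theta)=\alpha_\xi+\beta_\xi e^{\mathrm{i}\theta}+\beta_\xi^Te^{-\mathrm{i}\theta}$. $\lambda_{\min},\lambda_{\max}$ denote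 the smallest and largest eigenvalue of a Hermitian matrix, and $\kappa_2(A_n)=\lambda_{\max}(A_n)/\lambda_{\min}(A_n)$ ($A_n$ is symmetric positive definite). *)

theory Defs
  imports "HOL-Analysis.Analysis" "Jordan_Normal_Form.Char_Poly"
begin

text \<open>
  Nodes, basis functions and degrees of freedom are numbered from 1, whereas the rows and columns
  of matrices are numbered from 0; hence the shifts by \<open>Suc\<close> below.
\<close>

definition nodal_basis :: "nat \<Rightarrow> (nat \<Rightarrow> real) \<Rightarrow> nat \<Rightarrow> real poly" where
  "nodal_basis r \<xi> i =
    (THE p. degree p \<le> r \<and> (\<forall>j\<in>{1..r+1}. poly p (\<xi> j) = (if i = j then 1 else 0)))"

lemma nodal_basis_unique_existence:
  assumes inj: "inj_on \<xi> {1..r+1}" and i: "i \<in> {1..r+1}"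
  shows "\<exists>!p. degree p \<le> r \<and> (\<forall>j\<in>{1..r+1}. poly p (\<xi> j) = (if i = j then 1 else (0::real)))"
proof (rule ex_ex1I)
  define S where "S = {1..r+1} - {i}"
  define q where "q = (\<Prod>j\<in>S. [:- \<xi> j, 1:])"
  have S: "finite S" "card S = r" using i by (auto simp: S_def)
  have q: "poly q x = (\<Prod>j\<in>S. x - \<xi> j)" for x
    by (simp add: q_def poly_prod)
  have ne: "poly q (\<xi> i) \<noteq> 0"
    using inj i S by (auto simp: q S_def inj_on_def)
  have deg: "degree q \<le> r"
    using degree_prod_sum_le[OF S(1), of "\<lambda>j. [:- \<xi> j, 1:]"] S(2) by (simp add: q_def)
  have zero: "poly q (\<xi> j) = 0" if "j \<in> {1..r+1}" "j \<noteq> i" for j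
    using that S by (auto simp: q S_def)
  have "degree (Polynomial.smult (1 / poly q (\<xi> i)) q) \<le> r"
    using deg degree_smult_le order_trans by blast
  then show "\<exists>p. degree p \<le> r \<and> (\<forall>j\<in>{1..r+1}. poly p (\<xi> j) = (if i = j then 1 else 0))"
    using ne zero by (intro exI[of _ "Polynomial.smult (1 / poly q (\<xi> i)) q"]) auto
next
  fix p p' :: "real poly"
  assume p: "degree p \<le> r \<and> (\<forall>j\<in>{1..r+1}. poly p (\<xi> j) = (if i = j then 1 else 0))"
    and p': "degree p' \<le> r \<and> (\<forall>j\<in>{1..r+1}. poly p' (\<xi> j) = (if i = j then 1 else 0))"
  show "p = p'"
  proof (rule ccontr)
    assume "p \<noteq> p'"
    then have nz: "p - p' \<noteq> 0" by simp
    have "card (\<xi> ` {1..r+1}) \<le> card {x. poly (p - p') x = 0}"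
      using p p' by (intro card_mono poly_roots_finite nz) auto
    also have "\<dots> \<le> degree (p - p')" by (rule card_poly_roots_bound[OF nz])
    also have "\<dots> \<le> r" using p p' degree_diff_le by blast
    finally show False using card_image[OF inj] by simp
  qed
qed

definition A_loc :: "nat \<Rightarrow> (nat \<Rightarrow> real) \<Rightarrow> nat \<Rightarrow> nat \<Rightarrow> real" where
  "A_loc r \<xi> i j = integral {0..1}
    (\<lambda>x. poly (pderiv (nodal_basis r \<xi> i)) x * poly (pderiv (nodal_basis r \<xi> j)) x)"

definition LTG :: "nat \<Rightarrow> nat \<Rightarrow> nat \<Rightarrow> nat" where
  "LTG r i k = (k - 1) * r + i"

definition assembled_matrix :: "nat \<Rightarrow> (nat \<Rightarrow> real) \<Rightarrow> nat \<Rightarrow> real mat" where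
  "assembled_matrix r \<xi> n = mat (n * r + 1) (n * r + 1) (\<lambda>(p, q).
    \<Sum>k=1..n. \<Sum>i=1..r+1. \<Sum>j=1..r+1.
      if LTG r i k = Suc p \<and> LTG r j k = Suc q then A_loc r \<xi> i j else 0)"

definition stiffness_matrix :: "nat \<Rightarrow> (nat \<Rightarrow> real) \<Rightarrow> nat \<Rightarrow> real mat" where
  "stiffness_matrix r \<xi> n = mat_delete (mat_delete (assembled_matrix r \<xi> n) (n * r) (n * r)) 0 0"

definition A_xi :: "nat \<Rightarrow> (nat \<Rightarrow> real) \<Rightarrow> real mat" where
  "A_xi r \<xi> = mat (r + 1) (r + 1) (\<lambda>(i, j).
    if (i, j) = (0, 0) \<or> (i, j) = (r, r) then A_loc r \<xi> 1 1 + A_loc r \<xi> (r+1) (r+1)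
    else A_loc r \<xi> (Suc i) (Suc j))"

definition alpha_xi :: "nat \<Rightarrow> (nat \<Rightarrow> real) \<Rightarrow> real mat" where
  "alpha_xi r \<xi> = mat r r (\<lambda>(i, j). A_xi r \<xi> $$ (i, j))"

definition beta_xi :: "nat \<Rightarrow> (nat \<Rightarrow> real) \<Rightarrow> real mat" where
  "beta_xi r \<xi> = mat r r (\<lambda>(i, j). if i = 0 then A_xi r \<xi> $$ (r, j) else 0)"

definition symbol :: "nat \<Rightarrow> (nat \<Rightarrow> real) \<Rightarrow> real \<Rightarrow> complex mat" where
  "symbol r \<xi> \<theta> = map_mat of_real (alpha_xi r \<xi>)
    + exp (\<i> * of_real \<theta>) \<cdot>\<^sub>m map_mat of_real (beta_xi r \<xi>)
    + exp (- \<i> * of_real \<theta>) \<cdot>\<^sub>m map_mat of_real (transpose_mat (beta_xi r \<xi>))"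

text \<open>
  Extreme eigenvalues of a nonempty Hermitian matrix, real or complex: all its eigenvalues are real,
  so collecting the real ones loses nothing. The values for other matrices are not meaningful.
\<close>

definition lambda_min :: "'a :: real_field mat \<Rightarrow> real" where
  "lambda_min A = Min {x. eigenvalue A (of_real x)}"

definition lambda_max :: "'a :: real_field mat \<Rightarrow> real" where
  "lambda_max A = Max {x. eigenvalue A (of_real x)}"

definition kappa2 :: "real mat \<Rightarrow> real" where
  "kappa2 A = lambda_max A / lambda_min A"

end

theory Submission
  imports Defs
begin

text \<open>
  Everything rests on one fact: for coefficients \<open>v\<close> on a single element, \<open>local_energy r \<xi> v\<close> is the
  Dirichlet energy \<open>\<integral>\<bar>p'\<bar>\<^sup>2\<close> of the interpolant \<open>p\<close> of \<open>v\<close>, and both matrices of the theorem are assembled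
  from it. The form of the stiffness matrix is the sum of the energies of the elements
  (\<open>herm_form_stiffness\<close>); the form of the symbol at \<open>\<theta>\<close> is the energy of one element whose right end
  value is \<open>exp (-\<i>\<theta>)\<close> times its left end value (\<open>herm_form_symbol\<close>). With the Rayleigh characterisation
  of extreme eigenvalues (\<open>lambda_max_hermitian\<close>, \<open>lambda_min_hermitian\<close>) the theorem becomes a
  collection of statements about energies.
  
  Largest eigenvalue. A coefficient vector that vanishes at both ends of the mesh is periodic, and a
  discrete Fourier transform over the elements turns it into such quasi-periodic element vectors, at
  angles in \<open>[-\<pi>, \<pi>]\<close>, preserving both the energy and the norm on average. Hence the Rayleigh quotients
  of the stiffness matrix never exceed the maximum \<open>M\<close> of \<open>lambda_max\<close> over the symbol
  (\<open>stiffness_form_le\<close>). Conversely, a truncated plane wave built from a top eigenvector of the symbol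
  has energy \<open>M\<close> per element except in the two outermost elements, so \<open>M\<close> is reached up to a
  factor \<open>1 - 2/n\<close> (\<open>lambda_max_stiffness_ge\<close>). The maximum \<open>M\<close> exists because \<open>lambda_max\<close> of a
  Hermitian matrix depends continuously on its entries.
  
  Smallest eigenvalue. Nodal values differ within an element by at most the square root of its energy;
  summing from the left boundary gives a discrete Poincare inequality with constant of order \<open>n\<^sup>2\<close>
  (\<open>discrete_poincare\<close>). The discrete sine with zeros at the two ends shows that the order is right
  (\<open>lambda_min_stiffness_le\<close>). The bounds on the condition number follow.
\<close>

section \<open>Rayleigh quotients of Hermitian matrices\<close>

definition herm_form :: "complex mat \<Rightarrow> (nat \<Rightarrow> complex) \<Rightarrow> complex" where
  "herm_form A x = (\<Sum>i<dim_row A. \<Sum>j<dim_row A. cnj (x i) * A $$ (i, j) * x j)"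

definition norm2 :: "nat \<Rightarrow> (nat \<Rightarrow> complex) \<Rightarrow> real" where
  "norm2 n x = (\<Sum>i<n. (cmod (x i))\<^sup>2)"

definition hermitian :: "complex mat \<Rightarrow> bool" where
  "hermitian A \<longleftrightarrow> dim_col A = dim_row A \<and>
    (\<forall>i<dim_row A. \<forall>j<dim_row A. A $$ (i, j) = cnj (A $$ (j, i)))"

lemma hermitianD:
  assumes "hermitian A" "A \<in> carrier_mat n n" "i < n" "j < n"
  shows "A $$ (i, j) = cnj (A $$ (j, i))"
  using assms unfolding hermitian_def by (metis carrier_matD(1))

lemma hermitianI:
  assumes "A \<in> carrier_mat n n"
    and "\<And>i j. i < n \<Longrightarrow> j < n \<Longrightarrow> A $$ (i, j) = cnj (A $$ (j, i))"
  shows "hermitian A"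
  using assms unfolding hermitian_def by (metis carrier_matD)

lemma norm2_nonneg: "norm2 n x \<ge> 0"
  by (simp add: norm2_def sum_nonneg)

lemma norm2_eq_0: "norm2 n x = 0 \<longleftrightarrow> (\<forall>i<n. x i = 0)"
  by (auto simp: norm2_def sum_nonneg_eq_0_iff)

lemma norm2_cnj: "complex_of_real (norm2 n x) = (\<Sum>i<n. cnj (x i) * x i)"
  unfolding norm2_def of_real_sum complex_norm_square by (simp add: mult.commute)

lemma cmod_mult_le_norm2:
  assumes "i < n" "j < n"
  shows "cmod (x i) * cmod (x j) \<le> norm2 n x"
proof -
  have ge: "(cmod (x k))\<^sup>2 \<le> norm2 n x" if "k < n" for k
    unfolding norm2_def by (rule member_le_sum) (use that in auto)
  have "2 * (cmod (x i) * cmod (x j)) \<le> (cmod (x i))\<^sup>2 + (cmod (x j))\<^sup>2"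
    by (simp add: mult.assoc sum_squares_bound flip: mult.assoc)
  then show ?thesis using ge[OF assms(1)] ge[OF assms(2)] by linarith
qed

definition entry_sum :: "complex mat \<Rightarrow> real" where
  "entry_sum A = (\<Sum>i<dim_row A. \<Sum>j<dim_row A. cmod (A $$ (i, j)))"

lemma entry_sum_nonneg: "entry_sum A \<ge> 0"
  by (simp add: entry_sum_def sum_nonneg)

lemma cmod_herm_form_le: "cmod (herm_form A x) \<le> entry_sum A * norm2 (dim_row A) x"
proof -
  have "cmod (herm_form A x) \<le>
      (\<Sum>i<dim_row A. \<Sum>j<dim_row A. cmod (cnj (x i) * A $$ (i, j) * x j))"
    unfolding herm_form_def by (intro order_trans[OF norm_sum] sum_mono order_refl)
  also have "\<dots> \<le> (\<Sum>i<dim_row A. \<Sum>j<dim_row A. cmod (A $$ (i, j)) * norm2 (dim_row A) x)"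
  proof (intro sum_mono)
    fix i j assume "i \<in> {..<dim_row A}" "j \<in> {..<dim_row A}"
    then have "cmod (A $$ (i, j)) * (cmod (x i) * cmod (x j)) \<le> cmod (A $$ (i, j)) * norm2 (dim_row A) x"
      by (intro mult_left_mono cmod_mult_le_norm2) auto
    then show "cmod (cnj (x i) * A $$ (i, j) * x j) \<le> cmod (A $$ (i, j)) * norm2 (dim_row A) x"
      by (simp add: norm_mult mult_ac)
  qed
  also have "\<dots> = entry_sum A * norm2 (dim_row A) x"
    by (simp add: entry_sum_def sum_distrib_right)
  finally show ?thesis .
qed

lemma Re_herm_form_le: "\<bar>Re (herm_form A x)\<bar> \<le> entry_sum A * norm2 (dim_row A) x"
  using abs_Re_le_cmod[of "herm_form A x"] cmod_herm_form_le[of A x] by linarith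

text \<open>
  Evaluating the form at an eigenvector is how eigenvalues are bounded by form inequalities, and how
  extremal test vectors are obtained.
\<close>

lemma herm_form_eigen:
  assumes A: "A \<in> carrier_mat n n" and ev: "eigenvector A v k"
  shows "herm_form A (\<lambda>i. v $ i) = k * norm2 n (\<lambda>i. v $ i)" "norm2 n (\<lambda>i. v $ i) > 0"
proof -
  have v: "v \<in> carrier_vec n" "v \<noteq> 0\<^sub>v n" "A *\<^sub>v v = k \<cdot>\<^sub>v v"
    using ev A by (auto simp: eigenvector_def)
  have row: "(\<Sum>j<n. A $$ (i, j) * v $ j) = k * v $ i" if "i < n" for i
  proof -
    have "(A *\<^sub>v v) $ i = (\<Sum>j<n. A $$ (i, j) * v $ j)"
      using that A v(1) by (simp add: scalar_prod_def atLeast0LessThan)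
    then show ?thesis using v that by simp
  qed
  have "herm_form A (\<lambda>i. v $ i) = (\<Sum>i<n. cnj (v $ i) * (\<Sum>j<n. A $$ (i, j) * v $ j))"
    using A by (simp add: herm_form_def sum_distrib_left mult.assoc)
  also have "\<dots> = (\<Sum>i<n. k * (cnj (v $ i) * v $ i))"
    by (intro sum.cong) (auto simp: row)
  also have "\<dots> = k * norm2 n (\<lambda>i. v $ i)"
    by (simp add: norm2_cnj sum_distrib_left)
  finally show "herm_form A (\<lambda>i. v $ i) = k * norm2 n (\<lambda>i. v $ i)" .
  have "norm2 n (\<lambda>i. v $ i) \<noteq> 0"
    using v by (auto simp: norm2_eq_0 intro!: eq_vecI)
  then show "norm2 n (\<lambda>i. v $ i) > 0"
    using norm2_nonneg[of n "\<lambda>i. v $ i"] by linarith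
qed

text \<open>
  A nonsingular positive semidefinite matrix is bounded below, without any compactness argument: with
  \<open>y = C x\<close>, the form of \<open>B\<close> at \<open>x - t y\<close> is \<open>\<langle>x, B x\<rangle> - 2 t \<bar>x\<bar>\<^sup>2 + t\<^sup>2 \<langle>x, C x\<rangle>\<close>, nonnegative for every
  real \<open>t\<close>, and \<open>\<langle>x, C x\<rangle>\<close> is at most a constant times \<open>\<bar>x\<bar>\<^sup>2\<close>.
\<close>

lemma hermitian_psd_inverse_coercive:
  assumes B: "B \<in> carrier_mat n n" and herm: "hermitian B"
    and psd: "\<And>x. Re (herm_form B x) \<ge> 0"
    and C: "C \<in> carrier_mat n n" and inv: "B * C = 1\<^sub>m n"
  shows "norm2 n x \<le> (entry_sum C + 1) * Re (herm_form B x)"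
proof -
  define s where "s = entry_sum C + 1"
  have s: "s > 0" using entry_sum_nonneg[of C] by (simp add: s_def)
  define y where "y i = (\<Sum>j<n. C $$ (i, j) * x j)" for i
  \<comment> \<open>this \<open>t\<close> makes the quadratic term of the expansion absorb only half of the linear one\<close>
  define t where "t = complex_of_real (1 / s)"
  have t: "cnj t = t" by (simp add: t_def)
  define z where "z i = x i - t * y i" for i
  have By: "(\<Sum>j<n. B $$ (i, j) * y j) = x i" if i: "i < n" for i
  proof -
    have ent: "(\<Sum>j<n. B $$ (i, j) * C $$ (j, k)) = (if i = k then 1 else 0)" if k: "k < n" for k
    proof -
      have "(B * C) $$ (i, k) = (\<Sum>j<n. B $$ (i, j) * C $$ (j, k))"
        using i k B C by (simp add: scalar_prod_def atLeast0LessThan)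
      then show ?thesis using inv i k by simp
    qed
    have "(\<Sum>j<n. B $$ (i, j) * y j) = (\<Sum>j<n. \<Sum>k<n. B $$ (i, j) * C $$ (j, k) * x k)"
      by (simp add: y_def sum_distrib_left mult.assoc)
    also have "\<dots> = (\<Sum>k<n. (\<Sum>j<n. B $$ (i, j) * C $$ (j, k)) * x k)"
      by (subst sum.swap) (simp add: sum_distrib_right)
    also have "\<dots> = (\<Sum>k<n. if i = k then x k else 0)"
      by (intro sum.cong) (auto simp: ent)
    also have "\<dots> = x i" using i by simp
    finally show ?thesis .
  qed
  have adj: "B $$ (i, j) = cnj (B $$ (j, i))" if "i < n" "j < n" for i j
    by (rule hermitianD[OF herm B that])
  have xBy: "(\<Sum>i<n. \<Sum>j<n. cnj (x i) * B $$ (i, j) * y j) = norm2 n x"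
  proof -
    have "(\<Sum>i<n. \<Sum>j<n. cnj (x i) * B $$ (i, j) * y j)
        = (\<Sum>i<n. cnj (x i) * (\<Sum>j<n. B $$ (i, j) * y j))"
      by (simp add: sum_distrib_left mult.assoc)
    also have "\<dots> = (\<Sum>i<n. cnj (x i) * x i)" by (intro sum.cong) (auto simp: By)
    finally show ?thesis by (simp add: norm2_cnj)
  qed
  have yBx: "(\<Sum>i<n. \<Sum>j<n. cnj (y i) * B $$ (i, j) * x j) = norm2 n x"
  proof -
    have "(\<Sum>i<n. \<Sum>j<n. cnj (y i) * B $$ (i, j) * x j)
        = (\<Sum>j<n. \<Sum>i<n. cnj (y i) * B $$ (i, j) * x j)" by (rule sum.swap)
    also have "\<dots> = (\<Sum>j<n. \<Sum>i<n. cnj (cnj (x j) * B $$ (j, i) * y i))"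
    proof (intro sum.cong refl)
      fix i j assume "j \<in> {..<n}" "i \<in> {..<n}"
      then show "cnj (y i) * B $$ (i, j) * x j = cnj (cnj (x j) * B $$ (j, i) * y i)"
        using adj[of i j] by (simp add: mult_ac)
    qed
    also have "\<dots> = cnj (\<Sum>j<n. \<Sum>i<n. cnj (x j) * B $$ (j, i) * y i)" by simp
    finally show ?thesis by (simp only: xBy complex_cnj_complex_of_real)
  qed
  have yBy: "herm_form B y = cnj (herm_form C x)"
  proof -
    have "herm_form B y = (\<Sum>i<n. cnj (y i) * (\<Sum>j<n. B $$ (i, j) * y j))"
      using B by (simp add: herm_form_def sum_distrib_left mult.assoc)
    also have "\<dots> = (\<Sum>i<n. cnj (y i) * x i)" by (intro sum.cong) (auto simp: By)
    also have "\<dots> = cnj (\<Sum>i<n. cnj (x i) * y i)" by (simp add: mult.commute)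
    also have "(\<Sum>i<n. cnj (x i) * y i) = herm_form C x"
      using C by (simp add: herm_form_def y_def sum_distrib_left mult.assoc)
    finally show ?thesis .
  qed
  have expand: "herm_form B z = herm_form B x - t * norm2 n x - t * norm2 n x
      + t * t * herm_form B y"
  proof -
    have "herm_form B z = (\<Sum>i<n. \<Sum>j<n. cnj (x i) * B $$ (i, j) * x j
       - t * (cnj (x i) * B $$ (i, j) * y j)
       - t * (cnj (y i) * B $$ (i, j) * x j)
       + t * t * (cnj (y i) * B $$ (i, j) * y j))"
      using B by (simp add: herm_form_def z_def t algebra_simps)
    also have "\<dots> = herm_form B x
       - t * (\<Sum>i<n. \<Sum>j<n. cnj (x i) * B $$ (i, j) * y j)
       - t * (\<Sum>i<n. \<Sum>j<n. cnj (y i) * B $$ (i, j) * x j)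
       + t * t * herm_form B y"
      using B by (simp add: herm_form_def sum.distrib sum_subtractf sum_distrib_left)
    finally show ?thesis by (simp only: xBy yBx)
  qed
  have "Re (herm_form B y) \<le> s * norm2 n x"
    using Re_herm_form_le[of C x] C norm2_nonneg[of n x] by (simp add: yBy s_def algebra_simps)
  then have "(1 / s) * (1 / s) * Re (herm_form B y) \<le> (1 / s) * (1 / s) * (s * norm2 n x)"
    using s by (intro mult_left_mono) auto
  also have "\<dots> = (1 / s) * norm2 n x" using s by simp
  finally have le: "(1 / s) * (1 / s) * Re (herm_form B y) \<le> (1 / s) * norm2 n x" .
  have "Re (herm_form B z) = Re (herm_form B x) - (1 / s) * norm2 n x - (1 / s) * norm2 n x
      + (1 / s) * (1 / s) * Re (herm_form B y)"
    unfolding expand by (simp add: t_def)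
  then have "(1 / s) * norm2 n x \<le> Re (herm_form B x)"
    using psd[of z] le by linarith
  then show ?thesis using s by (simp add: s_def field_simps)
qed

lemma herm_form_char_matrix:
  assumes A: "A \<in> carrier_mat n n"
  shows "herm_form (- char_matrix A (of_real \<mu>)) x = of_real \<mu> * norm2 n x - herm_form A x"
proof -
  have ent: "(- char_matrix A (of_real \<mu>)) $$ (i, j) = (if i = j then of_real \<mu> else 0) - A $$ (i, j)"
    if "i < n" "j < n" for i j
    using that A by (auto simp: char_matrix_def)
  have "herm_form (- char_matrix A (of_real \<mu>)) x
      = (\<Sum>i<n. \<Sum>j<n. (if i = j then of_real \<mu> * (cnj (x i) * x j) else 0) - cnj (x i) * A $$ (i, j) * x j)"
    using A unfolding herm_form_def by (auto simp: char_matrix_def ent algebra_simps intro!: sum.cong)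
  also have "\<dots> = (\<Sum>i<n. of_real \<mu> * (cnj (x i) * x i)) - herm_form A x"
    using A by (simp add: herm_form_def sum_subtractf)
  also have "(\<Sum>i<n. of_real \<mu> * (cnj (x i) * x i)) = of_real \<mu> * norm2 n x"
    by (simp add: norm2_cnj sum_distrib_left)
  finally show ?thesis .
qed

text \<open>
  The supremum \<open>\<mu>\<close> of the Rayleigh quotients makes \<open>\<mu> I - A\<close> positive semidefinite. Were that matrix
  nonsingular, coercivity would leave a gap below \<open>\<mu>\<close>, against its being the supremum; hence \<open>\<mu>\<close> is an
  eigenvalue.
\<close>

lemma hermitian_top_eigenvalue:
  assumes A: "A \<in> carrier_mat n n" and herm: "hermitian A" and n: "n > 0"
  shows "\<exists>\<mu>. eigenvalue A (of_real \<mu>) \<and> (\<forall>x. Re (herm_form A x) \<le> \<mu> * norm2 n x)"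
proof -
  define R where "R = {Re (herm_form A x) / norm2 n x |x. norm2 n x > 0}"
  have "norm2 n (\<lambda>i. 1) > 0" using n by (simp add: norm2_def)
  then have ne: "R \<noteq> {}" unfolding R_def by blast
  have "y \<le> entry_sum A" if y: "y \<in> R" for y
  proof -
    obtain x where x: "norm2 n x > 0" "y = Re (herm_form A x) / norm2 n x"
      using y by (auto simp: R_def)
    have "Re (herm_form A x) \<le> entry_sum A * norm2 n x" using Re_herm_form_le[of A x] A by auto
    then show ?thesis using x(1) unfolding x(2) by (simp add: pos_divide_le_eq)
  qed
  then have bdd: "bdd_above R" by (auto simp: bdd_above_def)
  define \<mu> where "\<mu> = Sup R"
  have le: "Re (herm_form A x) \<le> \<mu> * norm2 n x" for x
  proof (cases "norm2 n x > 0")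
    case True
    then have "Re (herm_form A x) / norm2 n x \<le> \<mu>"
      unfolding \<mu>_def by (intro cSup_upper bdd) (auto simp: R_def)
    then show ?thesis using True by (simp add: field_simps)
  next
    case False
    then have "norm2 n x = 0" using norm2_nonneg[of n x] by linarith
    then show ?thesis using Re_herm_form_le[of A x] A by auto
  qed
  define B where "B = - char_matrix A (of_real \<mu>)"
  have cA: "char_matrix A (of_real \<mu>) \<in> carrier_mat n n" using A by simp
  then have B: "B \<in> carrier_mat n n" by (simp add: B_def)
  have formB: "Re (herm_form B x) = \<mu> * norm2 n x - Re (herm_form A x)" for x
    unfolding B_def herm_form_char_matrix[OF A] by simp
  have "eigenvalue A (of_real \<mu>)"
  proof (rule ccontr)
    assume "\<not> eigenvalue A (of_real \<mu>)"
    then have "Determinant.det B \<noteq> 0"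
      using eigenvalue_det[OF A] det_0_negate[OF cA] by (auto simp: B_def)
    then have "B \<in> Units (ring_mat TYPE(complex) n ())"
      by (rule det_non_zero_imp_unit[OF B])
    then obtain C where C: "C \<in> carrier_mat n n" "B * C = 1\<^sub>m n"
      by (auto simp: Units_def ring_mat_simps)
    have hB: "hermitian B"
    proof -
      have "B $$ (i, j) = cnj (B $$ (j, i))" if ij: "i < n" "j < n" for i j
      proof -
        have "A $$ (i, j) = cnj (A $$ (j, i))" by (rule hermitianD[OF herm A ij])
        then have "cnj (A $$ (j, i)) = A $$ (i, j)" by simp
        then show ?thesis using ij A by (simp add: B_def char_matrix_def)
      qed
      then show ?thesis by (rule hermitianI[OF B])
    qed
    define s where "s = entry_sum C + 1"
    have s: "s > 0" using entry_sum_nonneg[of C] by (simp add: s_def)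
    have "norm2 n x \<le> s * Re (herm_form B x)" for x
      unfolding s_def using le by (intro hermitian_psd_inverse_coercive B hB C) (simp add: formB)
    then have gap: "norm2 n x \<le> s * (\<mu> * norm2 n x - Re (herm_form A x))" for x
      by (simp add: formB)
    have "y \<le> \<mu> - 1 / s" if y: "y \<in> R" for y
    proof -
      obtain x where x: "norm2 n x > 0" "y = Re (herm_form A x) / norm2 n x"
        using y by (auto simp: R_def)
      have "Re (herm_form A x) = y * norm2 n x" using x by simp
      then have "norm2 n x * 1 \<le> norm2 n x * (s * (\<mu> - y))"
        using gap[of x] by (simp add: algebra_simps)
      then have "1 \<le> s * (\<mu> - y)" using x(1) by (simp only: mult_le_cancel_left_pos)
      then show ?thesis using s by (simp add: field_simps)
    qed
    then have "\<mu> \<le> \<mu> - 1 / s" unfolding \<mu>_def by (intro cSup_least ne)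
    then show False using s by simp
  qed
  then show ?thesis using le by blast
qed

lemma finite_real_eigenvalues:
  fixes A :: "'a :: {real_field} mat"
  assumes A: "A \<in> carrier_mat n n"
  shows "finite {x::real. eigenvalue A (of_real x)}"
proof -
  have "monic (char_poly A)" using degree_monic_char_poly[OF A] by simp
  then have "char_poly A \<noteq> 0" by auto
  then have "finite {k. poly (char_poly A) k = 0}" by (rule poly_roots_finite)
  then have "finite (of_real -` {k. poly (char_poly A) k = 0} :: real set)"
    by (rule finite_vimageI) (simp add: inj_on_def)
  then show ?thesis
    by (rule finite_subset[rotated]) (auto simp: eigenvalue_root_char_poly[OF A])
qed

lemma lambda_max_hermitian:
  assumes A: "A \<in> carrier_mat n n" and herm: "hermitian A" and n: "n > 0"
  shows "eigenvalue A (of_real (lambda_max A))"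
    and "Re (herm_form A x) \<le> lambda_max A * norm2 n x"
proof -
  obtain \<mu> where \<mu>: "eigenvalue A (of_real \<mu>)" "\<And>x. Re (herm_form A x) \<le> \<mu> * norm2 n x"
    using hermitian_top_eigenvalue[OF assms] by blast
  have "x \<le> \<mu>" if x: "eigenvalue A (of_real x)" for x
  proof -
    obtain v where v: "eigenvector A v (of_real x)" using x by (auto simp: eigenvalue_def)
    have "x * norm2 n (\<lambda>i. v $ i) \<le> \<mu> * norm2 n (\<lambda>i. v $ i)"
      using \<mu>(2)[of "\<lambda>i. v $ i"] herm_form_eigen(1)[OF A v] by simp
    then show ?thesis using herm_form_eigen(2)[OF A v] by simp
  qed
  then have "lambda_max A = \<mu>"
    unfolding lambda_max_def using \<mu>(1) by (intro Max_eqI finite_real_eigenvalues[OF A]) auto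
  then show "eigenvalue A (of_real (lambda_max A))" "Re (herm_form A x) \<le> lambda_max A * norm2 n x"
    using \<mu> by auto
qed

lemma eigenvalue_uminus:
  fixes A :: "'a :: field mat"
  assumes A: "A \<in> carrier_mat n n"
  shows "eigenvalue (- A) (- k) \<longleftrightarrow> eigenvalue A k"
proof -
  have "char_matrix (- A) (- k) = - char_matrix A k"
    using A by (intro eq_matI) (auto simp: char_matrix_def)
  then show ?thesis
    using A det_0_negate[of "char_matrix A k" n] by (simp add: eigenvalue_det[of _ n])
qed

lemma lambda_min_hermitian:
  assumes A: "A \<in> carrier_mat n n" and herm: "hermitian A" and n: "n > 0"
  shows "eigenvalue A (of_real (lambda_min A))"
    and "lambda_min A * norm2 n x \<le> Re (herm_form A x)"
proof -
  have "hermitian (- A)"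
  proof (rule hermitianI)
    fix i j assume ij: "i < n" "j < n"
    have "cnj (A $$ (j, i)) = A $$ (i, j)" using hermitianD[OF herm A ij] by simp
    then show "(- A) $$ (i, j) = cnj ((- A) $$ (j, i))" using A ij by simp
  qed (use A in simp)
  then obtain \<nu> where \<nu>: "eigenvalue (- A) (of_real \<nu>)"
      "\<And>x. Re (herm_form (- A) x) \<le> \<nu> * norm2 n x"
    using hermitian_top_eigenvalue[of "- A" n] A n by auto
  have neg: "herm_form (- A) x = - herm_form A x" for x
    using A by (simp add: herm_form_def sum_negf)
  have ev: "eigenvalue A (of_real (- \<nu>))"
    using eigenvalue_uminus[OF A, of "of_real (- \<nu>)"] \<nu>(1) by simp
  have le: "- \<nu> * norm2 n x \<le> Re (herm_form A x)" for x
    using \<nu>(2)[of x] by (simp add: neg)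
  have "- \<nu> \<le> x" if x: "eigenvalue A (of_real x)" for x
  proof -
    obtain v where v: "eigenvector A v (of_real x)" using x by (auto simp: eigenvalue_def)
    have "- \<nu> * norm2 n (\<lambda>i. v $ i) \<le> x * norm2 n (\<lambda>i. v $ i)"
      using le[of "\<lambda>i. v $ i"] herm_form_eigen(1)[OF A v] by simp
    then show ?thesis using herm_form_eigen(2)[OF A v] by (simp only: mult_le_cancel_right_pos)
  qed
  then have "lambda_min A = - \<nu>"
    unfolding lambda_min_def using ev by (intro Min_eqI finite_real_eigenvalues[OF A]) auto
  then show "eigenvalue A (of_real (lambda_min A))"
    "lambda_min A * norm2 n x \<le> Re (herm_form A x)"
    using ev le by auto
qed

lemma eigenvalue_map_of_real:
  assumes A: "A \<in> carrier_mat n n"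
  shows "eigenvalue (map_mat complex_of_real A) (of_real x) \<longleftrightarrow> eigenvalue A x"
proof -
  have "char_poly (map_mat complex_of_real A) = map_poly of_real (char_poly A)"
    by (rule of_real_hom.char_poly_hom[OF A])
  then show ?thesis using A by (simp add: eigenvalue_root_char_poly[of _ n])
qed

lemma lambda_max_map_of_real:
  assumes A: "A \<in> carrier_mat n n"
  shows "lambda_max (map_mat complex_of_real A) = lambda_max A"
  by (simp add: lambda_max_def eigenvalue_map_of_real[OF A])

lemma lambda_min_map_of_real:
  assumes A: "A \<in> carrier_mat n n"
  shows "lambda_min (map_mat complex_of_real A) = lambda_min A"
  by (simp add: lambda_min_def eigenvalue_map_of_real[OF A])

text \<open>
  Testing the form of \<open>B\<close> with a top eigenvector of \<open>A\<close>; this is what makes \<open>lambda_max\<close> continuous.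
\<close>

lemma lambda_max_diff_le:
  assumes A: "A \<in> carrier_mat n n" and hA: "hermitian A"
    and B: "B \<in> carrier_mat n n" and hB: "hermitian B" and n: "n > 0"
  shows "lambda_max A \<le> lambda_max B + entry_sum (A - B)"
proof -
  obtain v where v: "eigenvector A v (of_real (lambda_max A))"
    using lambda_max_hermitian(1)[OF A hA n] by (auto simp: eigenvalue_def)
  define x where "x i = v $ i" for i
  have pos: "norm2 n x > 0" and eig: "Re (herm_form A x) = lambda_max A * norm2 n x"
    using herm_form_eigen[OF A v] by (simp_all add: x_def[abs_def])
  have "herm_form (A - B) x = (\<Sum>i<n. \<Sum>j<n. cnj (x i) * A $$ (i, j) * x j - cnj (x i) * B $$ (i, j) * x j)"
    using A B by (simp add: herm_form_def algebra_simps)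
  also have "\<dots> = herm_form A x - herm_form B x"
    using A B by (simp add: herm_form_def sum_subtractf)
  finally have "herm_form A x = herm_form B x + herm_form (A - B) x" by simp
  then have "lambda_max A * norm2 n x \<le> (lambda_max B + entry_sum (A - B)) * norm2 n x"
    using eig lambda_max_hermitian(2)[OF B hB n, of x] Re_herm_form_le[of "A - B" x] A B
    by (simp add: algebra_simps)
  then show ?thesis using pos by simp
qed

section \<open>The Dirichlet energy of one element\<close>

definition local_energy :: "nat \<Rightarrow> (nat \<Rightarrow> real) \<Rightarrow> (nat \<Rightarrow> complex) \<Rightarrow> complex" where
  "local_energy r \<xi> v =
    (\<Sum>i\<le>r. \<Sum>j\<le>r. cnj (v i) * of_real (A_loc r \<xi> (Suc i) (Suc j)) * v j)"

text \<open>
  With \<open>d = p x - p 0 = \<integral> p'\<close> over \<open>[0, x]\<close>, integrating \<open>(p' - d)\<^sup>2 \<ge> 0\<close> over that interval gives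
  \<open>\<integral> p'\<^sup>2 \<ge> 2 d\<^sup>2 - x d\<^sup>2\<close>, which is at least \<open>d\<^sup>2\<close> since \<open>x \<le> 1\<close>.
\<close>

lemma poly_diff_le_energy:
  fixes p :: "real poly"
  assumes x: "x \<in> {0..1}"
  shows "(poly p x - poly p 0)\<^sup>2 \<le> integral {0..1} (\<lambda>t. (poly (pderiv p) t)\<^sup>2)"
proof -
  define d where "d = poly p x - poly p 0"
  let ?g = "poly (pderiv p)"
  have d: "(?g has_integral d) {0..x}"
    unfolding d_def using x
    by (intro fundamental_theorem_of_calculus)
      (auto intro!: DERIV_subset[OF poly_DERIV] simp flip: has_real_derivative_iff_has_vector_derivative)
  define I where "I = integral {0..x} (\<lambda>t. (?g t)\<^sup>2)"
  have I: "((\<lambda>t. (?g t)\<^sup>2) has_integral I) {0..x}"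
    unfolding I_def by (intro integrable_integral integrable_continuous_interval continuous_intros)
  have "((\<lambda>t. (?g t)\<^sup>2 - 2 * d * ?g t + d\<^sup>2) has_integral (I - 2 * d * d + d\<^sup>2 * x)) {0..x}"
    using x by (intro has_integral_add has_integral_diff I has_integral_mult_right d)
      (use has_integral_const_real[of "d\<^sup>2" 0 x] in \<open>simp add: mult.commute\<close>)
  then have "0 \<le> I - 2 * d * d + d\<^sup>2 * x"
  proof (rule has_integral_nonneg)
    fix t
    have "(?g t)\<^sup>2 - 2 * d * ?g t + d\<^sup>2 = (?g t - d)\<^sup>2" by (simp add: power2_eq_square algebra_simps)
    then show "0 \<le> (?g t)\<^sup>2 - 2 * d * ?g t + d\<^sup>2" by simp
  qed
  moreover have "d\<^sup>2 * x \<le> d\<^sup>2 * 1" using x by (intro mult_left_mono) auto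
  ultimately have "d\<^sup>2 \<le> I" by (simp add: power2_eq_square)
  also have "I \<le> integral {0..1} (\<lambda>t. (?g t)\<^sup>2)"
    unfolding I_def using x
    by (intro integral_subset_le integrable_continuous_interval continuous_intros) auto
  finally show ?thesis by (simp add: d_def)
qed

lemma A_loc_sym: "A_loc r \<xi> i j = A_loc r \<xi> j i"
  by (simp add: A_loc_def mult.commute)

lemma A_loc_has_integral:
  "((\<lambda>x. poly (pderiv (nodal_basis r \<xi> i)) x * poly (pderiv (nodal_basis r \<xi> j)) x)
    has_integral A_loc r \<xi> i j) {0..1}"
  unfolding A_loc_def by (intro integrable_integral integrable_continuous_interval continuous_intros)

definition interpolant :: "nat \<Rightarrow> (nat \<Rightarrow> real) \<Rightarrow> (nat \<Rightarrow> real) \<Rightarrow> real poly" where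
  "interpolant r \<xi> c = (\<Sum>i\<le>r. Polynomial.smult (c i) (nodal_basis r \<xi> (Suc i)))"

lemma A_loc_quadratic_form:
  "(\<Sum>i\<le>r. \<Sum>j\<le>r. c i * A_loc r \<xi> (Suc i) (Suc j) * c j)
    = integral {0..1} (\<lambda>x. (poly (pderiv (interpolant r \<xi> c)) x)\<^sup>2)"
proof -
  let ?d = "\<lambda>i. poly (pderiv (nodal_basis r \<xi> (Suc i)))"
  have "((\<lambda>x. \<Sum>i\<le>r. \<Sum>j\<le>r. c i * (?d i x * ?d j x) * c j) has_integral
      (\<Sum>i\<le>r. \<Sum>j\<le>r. c i * A_loc r \<xi> (Suc i) (Suc j) * c j)) {0..1}"
    by (intro has_integral_sum has_integral_mult_left has_integral_mult_right A_loc_has_integral) auto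
  moreover have "(\<Sum>i\<le>r. \<Sum>j\<le>r. c i * (?d i x * ?d j x) * c j)
      = (poly (pderiv (interpolant r \<xi> c)) x)\<^sup>2" for x
    by (simp add: interpolant_def pderiv_sum pderiv_smult poly_sum power2_eq_square sum_product mult_ac)
  ultimately show ?thesis by (simp add: integral_unique)
qed

lemma Re_local_energy:
  "Re (local_energy r \<xi> v) =
    (\<Sum>i\<le>r. \<Sum>j\<le>r. Re (v i) * A_loc r \<xi> (Suc i) (Suc j) * Re (v j)) +
    (\<Sum>i\<le>r. \<Sum>j\<le>r. Im (v i) * A_loc r \<xi> (Suc i) (Suc j) * Im (v j))"
  by (simp add: local_energy_def algebra_simps flip: sum.distrib)

lemma local_energy_scale:
  "local_energy r \<xi> (\<lambda>i. c * v i) = of_real ((cmod c)\<^sup>2) * local_energy r \<xi> v"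
  unfolding local_energy_def complex_norm_square by (simp add: sum_distrib_left mult_ac)

definition energy_bound :: "nat \<Rightarrow> (nat \<Rightarrow> real) \<Rightarrow> real" where
  "energy_bound r \<xi> = (\<Sum>i\<le>r. \<Sum>j\<le>r. \<bar>A_loc r \<xi> (Suc i) (Suc j)\<bar>)"

lemma energy_bound_nonneg: "energy_bound r \<xi> \<ge> 0"
  by (simp add: energy_bound_def sum_nonneg)

locale element_nodes =
  fixes r :: nat and \<xi> :: "nat \<Rightarrow> real"
  assumes r: "r \<ge> 1"
    and nodes: "\<xi> ` {1..r+1} \<subseteq> {0..1}" and inj: "inj_on \<xi> {1..r+1}"
    and first: "\<xi> 1 = 0"
begin

lemma nodal_basis:
  assumes i: "i \<le> r"
  shows "degree (nodal_basis r \<xi> (Suc i)) \<le> r"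
    and "j \<le> r \<Longrightarrow> poly (nodal_basis r \<xi> (Suc i)) (\<xi> (Suc j)) = (if i = j then 1 else 0)"
  using theI'[OF nodal_basis_unique_existence[OF inj, of "Suc i"]] i
  unfolding nodal_basis_def[symmetric] by auto

lemma poly_interpolant:
  assumes "i \<le> r"
  shows "poly (interpolant r \<xi> c) (\<xi> (Suc i)) = c i"
proof -
  have "poly (interpolant r \<xi> c) (\<xi> (Suc i)) = (\<Sum>k\<le>r. c k * (if k = i then 1 else 0))"
    unfolding interpolant_def poly_sum using assms by (intro sum.cong) (auto simp: nodal_basis(2))
  also have "\<dots> = c i" using assms by (simp add: if_distrib cong: if_cong)
  finally show ?thesis .
qed

lemma A_loc_form_ge:
  assumes "i \<le> r"
  shows "(c i - c 0)\<^sup>2 \<le> (\<Sum>i\<le>r. \<Sum>j\<le>r. c i * A_loc r \<xi> (Suc i) (Suc j) * c j)"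
proof -
  have "\<xi> (Suc i) \<in> {0..1}" using assms nodes by (auto simp: image_subset_iff)
  from poly_diff_le_energy[OF this, of "interpolant r \<xi> c"] show ?thesis
    using poly_interpolant[of i c] poly_interpolant[of 0 c] assms first
    by (simp add: A_loc_quadratic_form)
qed

lemma local_energy_ge:
  assumes "i \<le> r"
  shows "(cmod (v i - v 0))\<^sup>2 \<le> Re (local_energy r \<xi> v)"
  using A_loc_form_ge[OF assms, of "\<lambda>i. Re (v i)"] A_loc_form_ge[OF assms, of "\<lambda>i. Im (v i)"]
  by (simp add: Re_local_energy cmod_power2)

lemma local_energy_nonneg: "Re (local_energy r \<xi> v) \<ge> 0"
  using local_energy_ge[of 0 v] by simp

lemma interpolant_1: "interpolant r \<xi> (\<lambda>_. 1) = 1"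
proof (rule ccontr)
  let ?p = "interpolant r \<xi> (\<lambda>_. 1) - 1"
  assume "interpolant r \<xi> (\<lambda>_. 1) \<noteq> 1"
  then have nz: "?p \<noteq> 0" by simp
  have "degree (interpolant r \<xi> (\<lambda>_. 1)) \<le> r"
    unfolding interpolant_def using nodal_basis(1) by (intro degree_sum_le) auto
  then have deg: "degree ?p \<le> r" by (intro degree_diff_le) auto
  have "\<xi> k \<in> {x. poly ?p x = 0}" if "k \<in> {1..r+1}" for k
  proof -
    from that obtain i where "k = Suc i" "i \<le> r" by (cases k) auto
    then show ?thesis using poly_interpolant[of i "\<lambda>_. 1"] by simp
  qed
  then have "card (\<xi> ` {1..r+1}) \<le> card {x. poly ?p x = 0}"
    by (intro card_mono poly_roots_finite[OF nz]) auto
  also have "\<dots> \<le> r" using card_poly_roots_bound[OF nz] deg by simp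
  finally show False using card_image[OF inj] by simp
qed

text \<open>
  The nodal basis sums to one, so constants have zero gradient and lie in the kernel of the local
  matrix.
\<close>

lemma A_loc_row_sum: "(\<Sum>j\<le>r. A_loc r \<xi> i (Suc j)) = 0"
proof -
  let ?d = "\<lambda>i. poly (pderiv (nodal_basis r \<xi> i))"
  have "((\<lambda>x. \<Sum>j\<le>r. ?d i x * ?d (Suc j) x) has_integral (\<Sum>j\<le>r. A_loc r \<xi> i (Suc j))) {0..1}"
    by (intro has_integral_sum A_loc_has_integral) auto
  moreover have "(\<Sum>j\<le>r. ?d i x * ?d (Suc j) x) = 0" for x
  proof -
    have "(\<Sum>j\<le>r. ?d i x * ?d (Suc j) x) = ?d i x * poly (pderiv (interpolant r \<xi> (\<lambda>_. 1))) x"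
      by (simp add: interpolant_def pderiv_sum poly_sum sum_distrib_left)
    then show ?thesis by (simp add: interpolant_1)
  qed
  ultimately show ?thesis using has_integral_unique has_integral_0 by fastforce
qed

lemma local_energy_shift: "local_energy r \<xi> (\<lambda>i. v i - c) = local_energy r \<xi> v"
proof -
  let ?a = "\<lambda>i j. complex_of_real (A_loc r \<xi> (Suc i) (Suc j))"
  have row: "(\<Sum>j\<le>r. ?a i j) = 0" for i
    using A_loc_row_sum[of "Suc i"] by (simp flip: of_real_sum)
  then have col: "(\<Sum>i\<le>r. ?a i j) = 0" for j
    by (subst A_loc_sym) simp
  have "local_energy r \<xi> (\<lambda>i. v i - c) = (\<Sum>i\<le>r. \<Sum>j\<le>r. cnj (v i) * ?a i j * v j
      - cnj (v i - c) * c * ?a i j - cnj c * v j * ?a i j)"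
    by (simp add: local_energy_def algebra_simps)
  also have "\<dots> = local_energy r \<xi> v - (\<Sum>i\<le>r. cnj (v i - c) * c * (\<Sum>j\<le>r. ?a i j))
      - (\<Sum>i\<le>r. \<Sum>j\<le>r. cnj c * v j * ?a i j)"
    by (simp add: local_energy_def sum_subtractf sum_distrib_left)
  also have "(\<Sum>i\<le>r. \<Sum>j\<le>r. cnj c * v j * ?a i j) = (\<Sum>j\<le>r. cnj c * v j * (\<Sum>i\<le>r. ?a i j))"
    by (subst sum.swap) (simp add: sum_distrib_left)
  finally show ?thesis by (simp add: row col)
qed

lemma local_energy_le:
  assumes "\<And>i. i \<le> r \<Longrightarrow> cmod (v i - v 0) \<le> D"
  shows "Re (local_energy r \<xi> v) \<le> energy_bound r \<xi> * D\<^sup>2"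
proof -
  let ?w = "\<lambda>i. v i - v 0"
  have "Re (local_energy r \<xi> v) \<le> cmod (local_energy r \<xi> ?w)"
    unfolding local_energy_shift by (rule complex_Re_le_cmod)
  also have "\<dots> \<le> (\<Sum>i\<le>r. \<Sum>j\<le>r. cmod (cnj (?w i) * of_real (A_loc r \<xi> (Suc i) (Suc j)) * ?w j))"
    unfolding local_energy_def by (intro order_trans[OF norm_sum] sum_mono order_refl)
  also have "\<dots> \<le> (\<Sum>i\<le>r. \<Sum>j\<le>r. \<bar>A_loc r \<xi> (Suc i) (Suc j)\<bar> * D\<^sup>2)"
  proof (intro sum_mono)
    fix i j assume ij: "i \<in> {..r}" "j \<in> {..r}"
    have "\<bar>A_loc r \<xi> (Suc i) (Suc j)\<bar> * (cmod (?w i) * cmod (?w j))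
        \<le> \<bar>A_loc r \<xi> (Suc i) (Suc j)\<bar> * (D * D)"
      using assms[of i] assms[of j] ij order_trans[OF norm_ge_zero assms[of i]]
      by (intro mult_left_mono mult_mono) auto
    then show "cmod (cnj (?w i) * of_real (A_loc r \<xi> (Suc i) (Suc j)) * ?w j)
        \<le> \<bar>A_loc r \<xi> (Suc i) (Suc j)\<bar> * D\<^sup>2"
      by (simp add: norm_mult power2_eq_square mult_ac flip: complex_cnj_diff)
  qed
  also have "\<dots> = energy_bound r \<xi> * D\<^sup>2" by (simp add: energy_bound_def sum_distrib_right)
  finally show ?thesis .
qed

end

section \<open>Stiffness matrix and symbol as sums of element energies\<close>

text \<open>
  Mesh nodes are numbered \<open>0, \<dots>, n * r\<close>, node \<open>k * r + i\<close> being node \<open>i\<close> of element \<open>k\<close>. Row \<open>p\<close> of the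
  stiffness matrix belongs to node \<open>p + 1\<close>; the Dirichlet condition puts zeros at nodes \<open>0\<close> and \<open>N\<close>.
\<close>

definition extend0 :: "nat \<Rightarrow> (nat \<Rightarrow> complex) \<Rightarrow> nat \<Rightarrow> complex" where
  "extend0 N x g = (if 0 < g \<and> g < N then x (g - 1) else 0)"

lemma extend0_boundary [simp]: "extend0 N x 0 = 0" "extend0 N x N = 0"
  by (simp_all add: extend0_def)

abbreviation element_values :: "nat \<Rightarrow> (nat \<Rightarrow> complex) \<Rightarrow> nat \<Rightarrow> nat \<Rightarrow> complex" where
  "element_values r u k \<equiv> \<lambda>i. u (k * r + i)"

lemma stiffness_matrix_carrier: "stiffness_matrix r \<xi> n \<in> carrier_mat (n * r - 1) (n * r - 1)"
  by (simp add: stiffness_matrix_def assembled_matrix_def mat_delete_def)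

lemma stiffness_matrix_entry:
  assumes "p < n * r - 1" "q < n * r - 1"
  shows "stiffness_matrix r \<xi> n $$ (p, q) = (\<Sum>k<n. \<Sum>i\<le>r. \<Sum>j\<le>r.
    if k * r + i = Suc p \<and> k * r + j = Suc q then A_loc r \<xi> (Suc i) (Suc j) else 0)"
proof -
  have "stiffness_matrix r \<xi> n $$ (p, q) = assembled_matrix r \<xi> n $$ (Suc p, Suc q)"
    using assms by (simp add: stiffness_matrix_def assembled_matrix_def mat_delete_def)
  also have "\<dots> = (\<Sum>k=1..n. \<Sum>i=1..Suc r. \<Sum>j=1..Suc r.
      if LTG r i k = Suc (Suc p) \<and> LTG r j k = Suc (Suc q) then A_loc r \<xi> i j else 0)"
    using assms by (simp add: assembled_matrix_def)
  also have "\<dots> = (\<Sum>k<n. \<Sum>i\<le>r. \<Sum>j\<le>r.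
    if k * r + i = Suc p \<and> k * r + j = Suc q then A_loc r \<xi> (Suc i) (Suc j) else 0)"
    unfolding One_nat_def sum.atLeast1_atMost_eq lessThan_Suc_atMost by (simp add: LTG_def)
  finally show ?thesis .
qed

lemma sum_swap_1_2:
  "(\<Sum>j\<in>J. \<Sum>p\<in>P. \<Sum>q\<in>Q. f j p q) = (\<Sum>p\<in>P. \<Sum>q\<in>Q. \<Sum>j\<in>J. f j p q)"
  by (subst sum.swap, rule sum.cong[OF refl], rule sum.swap)

lemma sum_swap_3_2:
  "(\<Sum>k\<in>K. \<Sum>i\<in>I. \<Sum>j\<in>J. \<Sum>p\<in>P. \<Sum>q\<in>Q. f k i j p q)
    = (\<Sum>p\<in>P. \<Sum>q\<in>Q. \<Sum>k\<in>K. \<Sum>i\<in>I. \<Sum>j\<in>J. f k i j p q)"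
proof -
  have "(\<Sum>i\<in>I. \<Sum>j\<in>J. \<Sum>p\<in>P. \<Sum>q\<in>Q. f k i j p q)
      = (\<Sum>p\<in>P. \<Sum>q\<in>Q. \<Sum>i\<in>I. \<Sum>j\<in>J. f k i j p q)" for k
    by (rule trans[OF sum.cong[OF refl sum_swap_1_2] sum_swap_1_2])
  then show ?thesis by (simp only:) (rule sum_swap_1_2)
qed

text \<open>
  Assembly, read backwards: adding local matrices at the positions of their nodes means that the
  quadratic forms of the elements add up, and deleting the boundary rows and columns amounts to
  inserting zero boundary values.
\<close>

lemma herm_form_stiffness:
  "herm_form (map_mat of_real (stiffness_matrix r \<xi> n)) x =
    (\<Sum>k<n. local_energy r \<xi> (element_values r (extend0 (n * r) x) k))"
proof -
  let ?a = "\<lambda>i j. complex_of_real (A_loc r \<xi> (Suc i) (Suc j))"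
  define N where "N = n * r - 1"
  have u: "extend0 (n * r) x g = (\<Sum>p<N. if g = Suc p then x p else 0)" for g
  proof (cases g)
    case (Suc m)
    then have "(\<Sum>p<N. if g = Suc p then x p else 0) = (\<Sum>p<N. if p = m then x p else 0)"
      by (intro sum.cong) auto
    then show ?thesis using Suc by (auto simp: extend0_def N_def)
  qed simp
  have cu: "cnj (extend0 (n * r) x g) = (\<Sum>p<N. if g = Suc p then cnj (x p) else 0)" for g
    unfolding u cnj_sum by (intro sum.cong) auto
  have ent: "map_mat complex_of_real (stiffness_matrix r \<xi> n) $$ (p, q) =
      (\<Sum>k<n. \<Sum>i\<le>r. \<Sum>j\<le>r. if k * r + i = Suc p \<and> k * r + j = Suc q then ?a i j else 0)"
    if "p < N" "q < N" for p q
  proof -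
    have "map_mat complex_of_real (stiffness_matrix r \<xi> n) $$ (p, q) =
        of_real (stiffness_matrix r \<xi> n $$ (p, q))"
      using that stiffness_matrix_carrier[of r \<xi> n] by (auto simp: N_def)
    also have "\<dots> = (\<Sum>k<n. \<Sum>i\<le>r. \<Sum>j\<le>r.
        of_real (if k * r + i = Suc p \<and> k * r + j = Suc q then A_loc r \<xi> (Suc i) (Suc j) else 0))"
      using that by (simp only: stiffness_matrix_entry N_def of_real_sum)
    finally show ?thesis by (simp only: if_distrib of_real_0)
  qed
  have dim: "dim_row (map_mat complex_of_real (stiffness_matrix r \<xi> n)) = N"
    using stiffness_matrix_carrier[of r \<xi> n] by (auto simp: N_def)
  have "(\<Sum>k<n. local_energy r \<xi> (element_values r (extend0 (n * r) x) k)) =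
      (\<Sum>k<n. \<Sum>i\<le>r. \<Sum>j\<le>r. \<Sum>p<N. \<Sum>q<N.
        (if k * r + i = Suc p then cnj (x p) else 0) * ?a i j * (if k * r + j = Suc q then x q else 0))"
    unfolding local_energy_def cu unfolding u unfolding sum_distrib_right
    unfolding sum_distrib_left ..
  also have "\<dots> = (\<Sum>p<N. \<Sum>q<N. \<Sum>k<n. \<Sum>i\<le>r. \<Sum>j\<le>r.
        (if k * r + i = Suc p then cnj (x p) else 0) * ?a i j * (if k * r + j = Suc q then x q else 0))"
    by (rule sum_swap_3_2)
  also have "\<dots> = (\<Sum>p<N. \<Sum>q<N. cnj (x p) *
      (\<Sum>k<n. \<Sum>i\<le>r. \<Sum>j\<le>r. if k * r + i = Suc p \<and> k * r + j = Suc q then ?a i j else 0) * x q)"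
    unfolding sum_distrib_left sum_distrib_right by (intro sum.cong refl) auto
  also have "\<dots> = herm_form (map_mat of_real (stiffness_matrix r \<xi> n)) x"
    unfolding herm_form_def dim by (intro sum.cong refl) (simp add: ent)
  finally show ?thesis by simp
qed

text \<open>
  Only the first \<open>r\<close> nodes of each element are counted, so that shared nodes are not counted twice.
\<close>

lemma norm2_by_elements:
  assumes "n > 0" "r > 0"
  shows "norm2 (n * r - 1) x =
    (\<Sum>k<n. norm2 r (element_values r (extend0 (n * r) x) k))"
proof -
  define N where "N = n * r - 1"
  define u where "u = extend0 (n * r) x"
  have N: "n * r = Suc N" using assms by (simp add: N_def)
  have "(\<Sum>k<n. norm2 r (element_values r u k)) = (\<Sum>k<n. \<Sum>g\<in>{k*r..<k*r+r}. (cmod (u g))\<^sup>2)"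
    unfolding norm2_def sum.atLeastLessThan_shift_0[of _ "k * r" "k * r + r" for k]
    by (simp add: atLeast0LessThan)
  also have "\<dots> = (\<Sum>g<n*r. (cmod (u g))\<^sup>2)" by (rule sum.nat_group)
  also have "\<dots> = (\<Sum>p<N. (cmod (u (Suc p)))\<^sup>2)"
    unfolding N sum.lessThan_Suc_shift by (simp add: u_def)
  also have "\<dots> = norm2 N x"
    unfolding norm2_def by (intro sum.cong refl) (simp add: u_def extend0_def N)
  finally show ?thesis by (simp add: u_def N_def)
qed

lemma local_energy_cong:
  assumes "\<And>i. i \<le> r \<Longrightarrow> v i = w i"
  shows "local_energy r \<xi> v = local_energy r \<xi> w"
  unfolding local_energy_def by (intro sum.cong refl) (simp add: assms)

text \<open>
  Element values of a grid function that picks up the factor \<open>exp (-\<i>\<theta>)\<close> from one element to the next: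
  the right end node \<open>r\<close> is the left end node of the following element.
\<close>

definition floquet :: "nat \<Rightarrow> real \<Rightarrow> (nat \<Rightarrow> complex) \<Rightarrow> nat \<Rightarrow> complex" where
  "floquet r \<theta> w i = (if i < r then w i else exp (- \<i> * of_real \<theta>) * w 0)"

lemma symbol_carrier: "symbol r \<xi> \<theta> \<in> carrier_mat r r"
  by (simp add: symbol_def alpha_xi_def beta_xi_def)

lemma symbol_entry:
  assumes "i < r" "j < r"
  shows "symbol r \<xi> \<theta> $$ (i, j) = of_real (A_loc r \<xi> (Suc i) (Suc j))
    + (if i = 0 \<and> j = 0 then of_real (A_loc r \<xi> (Suc r) (Suc r)) else 0)
    + exp (\<i> * of_real \<theta>) * (if i = 0 then of_real (A_loc r \<xi> (Suc r) (Suc j)) else 0)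
    + exp (- \<i> * of_real \<theta>) * (if j = 0 then of_real (A_loc r \<xi> (Suc r) (Suc i)) else 0)"
  using assms by (auto simp: symbol_def alpha_xi_def beta_xi_def A_xi_def)

lemma cnj_exp_i: "cnj (exp (\<i> * of_real t)) = exp (- \<i> * of_real t)"
  "cnj (exp (- \<i> * of_real t)) = exp (\<i> * of_real t)"
  by (simp_all add: exp_cnj)

lemma hermitian_symbol: "hermitian (symbol r \<xi> \<theta>)"
proof (rule hermitianI[OF symbol_carrier])
  fix i j assume ij: "i < r" "j < r"
  show "symbol r \<xi> \<theta> $$ (i, j) = cnj (symbol r \<xi> \<theta> $$ (j, i))"
    unfolding symbol_entry[OF ij] symbol_entry[OF ij(2,1)] complex_cnj_add complex_cnj_mult cnj_exp_i
    using A_loc_sym[of r \<xi> "Suc i" "Suc j"] by auto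
qed

text \<open>
  The last row and column of the local matrix couple to \<open>exp (-\<i>\<theta>) * w 0\<close>: they contribute the two
  \<open>\<beta>\<close> terms of the symbol, and their common corner, where the phases cancel, the additional diagonal
  entry of \<open>\<alpha>\<close>.
\<close>

lemma herm_form_symbol:
  assumes r: "r \<ge> 1"
  shows "herm_form (symbol r \<xi> \<theta>) w = local_energy r \<xi> (floquet r \<theta> w)"
proof -
  let ?a = "\<lambda>i j. complex_of_real (A_loc r \<xi> (Suc i) (Suc j))"
  define e where "e = exp (\<i> * of_real \<theta>)"
  define e' where "e' = exp (- \<i> * of_real \<theta>)"
  have ee: "e * e' = 1" unfolding e_def e'_def by (simp flip: exp_add)
  have cnj_e': "cnj e' = e" unfolding e_def e'_def by (rule cnj_exp_i)
  have dim: "dim_row (symbol r \<xi> \<theta>) = r" using symbol_carrier[of r \<xi> \<theta>] by auto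
  have "herm_form (symbol r \<xi> \<theta>) w = (\<Sum>i<r. \<Sum>j<r. cnj (w i) * ?a i j * w j
      + (if i = 0 then if j = 0 then cnj (w 0) * ?a r r * w 0 else 0 else 0)
      + (if i = 0 then e * cnj (w 0) * ?a r j * w j else 0)
      + (if j = 0 then cnj (w i) * ?a r i * (e' * w 0) else 0))"
    unfolding herm_form_def dim
    by (intro sum.cong refl) (simp add: symbol_entry e_def e'_def algebra_simps)
  also have "\<dots> = (\<Sum>i<r. \<Sum>j<r. cnj (w i) * ?a i j * w j) + cnj (w 0) * ?a r r * w 0
      + (\<Sum>j<r. e * cnj (w 0) * ?a r j * w j) + (\<Sum>i<r. cnj (w i) * ?a r i * (e' * w 0))"
  proof -
    have "(\<Sum>i<r. \<Sum>j<r. if i = 0 then e * cnj (w 0) * ?a r j * w j else 0)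
        = (\<Sum>j<r. e * cnj (w 0) * ?a r j * w j)"
      using r by (subst sum.swap) simp
    moreover have "(\<Sum>i<r. \<Sum>j<r. if i = 0 then if j = 0 then cnj (w 0) * ?a r r * w 0 else 0 else 0)
        = cnj (w 0) * ?a r r * w 0"
      using r by (subst sum.swap) simp
    moreover have "(\<Sum>i<r. \<Sum>j<r. if j = 0 then cnj (w i) * ?a r i * (e' * w 0) else 0)
        = (\<Sum>i<r. cnj (w i) * ?a r i * (e' * w 0))"
      using r by simp
    ultimately show ?thesis by (simp only: sum.distrib)
  qed
  also have "\<dots> = local_energy r \<xi> (floquet r \<theta> w)"
  proof -
    have [simp]: "floquet r \<theta> w r = e' * w 0" "\<And>i. i < r \<Longrightarrow> floquet r \<theta> w i = w i"
      by (simp_all add: floquet_def e'_def)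
    have "local_energy r \<xi> (floquet r \<theta> w)
        = (\<Sum>i<r. \<Sum>j<r. cnj (w i) * ?a i j * w j) + (\<Sum>i<r. cnj (w i) * ?a i r * (e' * w 0))
        + ((\<Sum>j<r. e * cnj (w 0) * ?a r j * w j) + e * cnj (w 0) * ?a r r * (e' * w 0))"
      by (simp add: local_energy_def sum.distrib cnj_e' flip: lessThan_Suc_atMost cong: sum.cong_simp)
    moreover have "e * cnj (w 0) * ?a r r * (e' * w 0) = (e * e') * (cnj (w 0) * ?a r r * w 0)"
      by (simp only: mult_ac)
    moreover have "(\<Sum>i<r. cnj (w i) * ?a i r * (e' * w 0)) = (\<Sum>i<r. cnj (w i) * ?a r i * (e' * w 0))"
      by (intro sum.cong refl) (simp only: A_loc_sym)
    ultimately show ?thesis by (simp add: ee)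
  qed
  finally show ?thesis .
qed

section \<open>Discrete Fourier transform over the elements\<close>

text \<open>
  The shift by \<open>\<pi>\<close> puts the sampling angles into \<open>[-\<pi>, \<pi>]\<close>, so that no periodicity of the symbol has
  to be invoked.
\<close>

definition dft_angle :: "nat \<Rightarrow> nat \<Rightarrow> real" where
  "dft_angle n j = 2 * pi * real j / real n - pi"

lemma dft_angle_range:
  assumes "j < n"
  shows "dft_angle n j \<in> {-pi..pi}"
proof -
  have "2 * pi * real j \<le> 2 * pi * real n" using assms by (intro mult_left_mono) auto
  then show ?thesis using assms by (simp add: dft_angle_def divide_le_eq)
qed

lemma dft_orthogonality:
  assumes k: "k < n" and l: "l < n"
  shows "(\<Sum>j<n. exp (\<i> * of_real ((real k - real l) * dft_angle n j))) = (if k = l then of_nat n else 0)"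
proof (cases "k = l")
  case False
  define d where "d = real k - real l"
  define z where "z = exp (\<i> * of_real (2 * pi * d / real n))"
  have n: "n > 0" using k by simp
  have summand: "exp (\<i> * of_real (d * dft_angle n j)) = exp (- \<i> * of_real (d * pi)) * z ^ j" for j
  proof -
    have "\<i> * of_real (d * dft_angle n j)
        = - \<i> * of_real (d * pi) + of_nat j * (\<i> * of_real (2 * pi * d / real n))"
      by (simp add: dft_angle_def field_simps)
    then show ?thesis unfolding z_def by (simp only: exp_add exp_of_nat_mult)
  qed
  have z1: "z \<noteq> 1"
  proof
    assume "z = 1"
    then obtain m :: int where "2 * pi * d / real n = of_int (2 * m) * pi"
      by (auto simp: z_def exp_eq_1)
    then have "d = real n * real_of_int m" using n by (simp add: field_simps)
    then have "int k - int l = int n * m"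
      unfolding d_def by (metis of_int_diff of_int_eq_iff of_int_mult of_int_of_nat_eq)
    moreover have "\<bar>int k - int l\<bar> < int n" using k l by linarith
    ultimately have "int n * \<bar>m\<bar> < int n * 1" by (simp add: abs_mult)
    then have "m = 0" using n by simp
    with \<open>int k - int l = int n * m\<close> show False using False by simp
  qed
  have "z ^ n = exp (of_nat n * (\<i> * of_real (2 * pi * d / real n)))"
    unfolding z_def by (simp only: exp_of_nat_mult)
  also have "of_nat n * (\<i> * of_real (2 * pi * d / real n)) = \<i> * of_real (2 * pi * d)"
    using n by simp
  also have "exp \<dots> = 1"
    unfolding exp_eq_1 d_def by (auto intro!: exI[of _ "int k - int l"])
  finally have "z ^ n = 1" .
  then have "(\<Sum>j<n. z ^ j) = 0" using z1 by (simp add: geometric_sum)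
  then show ?thesis using False unfolding d_def[symmetric] summand sum_distrib_left[symmetric] by simp
qed simp

definition fourier :: "nat \<Rightarrow> real \<Rightarrow> (nat \<Rightarrow> complex) \<Rightarrow> complex" where
  "fourier n \<theta> f = (\<Sum>k<n. f k * exp (\<i> * of_real (real k * \<theta>)))"

text \<open>
  Polarised form of Parseval's identity, needed because the energies pair different nodes \<open>i\<close> and \<open>j\<close>
  of an element.
\<close>

lemma fourier_parseval:
  "(\<Sum>j<n. cnj (fourier n (dft_angle n j) f) * fourier n (dft_angle n j) g)
    = of_nat n * (\<Sum>k<n. cnj (f k) * g k)"
proof -
  have summand: "cnj (fourier n t f) * fourier n t g
      = (\<Sum>l<n. \<Sum>k<n. cnj (f l) * g k * exp (\<i> * of_real ((real k - real l) * t)))" for t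
  proof -
    have e: "exp (\<i> * of_real ((real k - real l) * t))
        = cnj (exp (\<i> * of_real (real l * t))) * exp (\<i> * of_real (real k * t))" for k l
      unfolding cnj_exp_i exp_add[symmetric] by (simp add: algebra_simps)
    show ?thesis
      unfolding fourier_def cnj_sum sum_product complex_cnj_mult e
      by (intro sum.cong refl) (simp only: mult_ac)
  qed
  have "(\<Sum>j<n. cnj (fourier n (dft_angle n j) f) * fourier n (dft_angle n j) g)
      = (\<Sum>l<n. \<Sum>k<n. \<Sum>j<n. cnj (f l) * g k * exp (\<i> * of_real ((real k - real l) * dft_angle n j)))"
    unfolding summand by (rule sum_swap_1_2)
  also have "\<dots> = (\<Sum>l<n. \<Sum>k<n. if k = l then cnj (f l) * g k * of_nat n else 0)"
    unfolding sum_distrib_left[symmetric] by (intro sum.cong refl) (auto simp: dft_orthogonality simp del: of_real_mult of_real_diff)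
  also have "\<dots> = of_nat n * (\<Sum>k<n. cnj (f k) * g k)"
    by (simp add: sum_distrib_left mult_ac)
  finally show ?thesis .
qed

section \<open>The largest eigenvalue\<close>

context element_nodes
begin

abbreviation stiffness :: "nat \<Rightarrow> complex mat" where
  "stiffness n \<equiv> map_mat of_real (stiffness_matrix r \<xi> n)"

lemma stiffness_carrier: "stiffness n \<in> carrier_mat (n * r - 1) (n * r - 1)"
  using stiffness_matrix_carrier[of r \<xi> n] by simp

lemma hermitian_stiffness: "hermitian (stiffness n)"
proof (rule hermitianI[OF stiffness_carrier])
  fix p q assume pq: "p < n * r - 1" "q < n * r - 1"
  have "stiffness_matrix r \<xi> n $$ (p, q) = stiffness_matrix r \<xi> n $$ (q, p)"
    unfolding stiffness_matrix_entry[OF pq] stiffness_matrix_entry[OF pq(2,1)]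
    by (rule sum.cong[OF refl], subst sum.swap, intro sum.cong refl)
      (auto simp: A_loc_sym[of r \<xi> "Suc i" "Suc j" for i j])
  then show "stiffness n $$ (p, q) = cnj (stiffness n $$ (q, p))"
    using pq stiffness_matrix_carrier[of r \<xi> n] by simp
qed

lemma stiffness_eigenvalues:
  assumes "n * r \<ge> 2"
  shows "Re (herm_form (stiffness n) x) \<le> lambda_max (stiffness_matrix r \<xi> n) * norm2 (n * r - 1) x"
    and "lambda_min (stiffness_matrix r \<xi> n) * norm2 (n * r - 1) x \<le> Re (herm_form (stiffness n) x)"
    and "\<exists>x. norm2 (n * r - 1) x > 0 \<and> Re (herm_form (stiffness n) x)
      = lambda_max (stiffness_matrix r \<xi> n) * norm2 (n * r - 1) x"
    and "\<exists>x. norm2 (n * r - 1) x > 0 \<and> Re (herm_form (stiffness n) x)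
      = lambda_min (stiffness_matrix r \<xi> n) * norm2 (n * r - 1) x"
proof -
  have pos: "n * r - 1 > 0" using assms by simp
  note max = lambda_max_hermitian[OF stiffness_carrier hermitian_stiffness pos,
      unfolded lambda_max_map_of_real[OF stiffness_matrix_carrier]]
  note min = lambda_min_hermitian[OF stiffness_carrier hermitian_stiffness pos,
      unfolded lambda_min_map_of_real[OF stiffness_matrix_carrier]]
  show "Re (herm_form (stiffness n) x) \<le> lambda_max (stiffness_matrix r \<xi> n) * norm2 (n * r - 1) x"
    by (rule max(2))
  show "lambda_min (stiffness_matrix r \<xi> n) * norm2 (n * r - 1) x \<le> Re (herm_form (stiffness n) x)"
    by (rule min(2))
  have wit: "\<exists>x. norm2 (n * r - 1) x > 0 \<and> Re (herm_form (stiffness n) x) = \<mu> * norm2 (n * r - 1) x"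
    if ev: "eigenvalue (stiffness n) (of_real \<mu>)" for \<mu>
  proof -
    obtain v where v: "eigenvector (stiffness n) v (of_real \<mu>)"
      using ev by (auto simp: eigenvalue_def)
    then show ?thesis using herm_form_eigen[OF stiffness_carrier v] by auto
  qed
  show "\<exists>x. norm2 (n * r - 1) x > 0 \<and> Re (herm_form (stiffness n) x)
      = lambda_max (stiffness_matrix r \<xi> n) * norm2 (n * r - 1) x"
    by (rule wit[OF max(1)])
  show "\<exists>x. norm2 (n * r - 1) x > 0 \<and> Re (herm_form (stiffness n) x)
      = lambda_min (stiffness_matrix r \<xi> n) * norm2 (n * r - 1) x"
    by (rule wit[OF min(1)])
qed

text \<open>
  The right end of element \<open>k\<close> is the left end of element \<open>k + 1\<close>, so the two transforms differ by the
  phase \<open>exp (-\<i>\<theta>)\<close>; the boundary terms of the index shift vanish by the Dirichlet condition. This holds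
  for every \<open>\<theta>\<close>, not only for the sampling angles.
\<close>

lemma fourier_floquet:
  fixes u :: "nat \<Rightarrow> complex" and \<theta> :: real
  assumes u: "u 0 = 0" "u (n * r) = 0" and i: "i \<le> r"
  defines "V \<equiv> \<lambda>i. fourier n \<theta> (\<lambda>k. u (k * r + i))"
  shows "V i = floquet r \<theta> V i"
proof (cases "i < r")
  case False
  then have ir: "i = r" using i by simp
  define h where "h k = u (k * r) * exp (\<i> * of_real ((real k - 1) * \<theta>))" for k
  have "V r = (\<Sum>k<n. h (Suc k))"
    by (simp add: V_def fourier_def h_def add.commute)
  also have "\<dots> = (\<Sum>k<n. h k)"
    using sum.lessThan_Suc_shift[of h n] sum.lessThan_Suc[of h n] u by (simp add: h_def)
  also have "\<dots> = exp (- \<i> * of_real \<theta>) * V 0"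
  proof -
    have "h k = exp (- \<i> * of_real \<theta>) * (u (k * r) * exp (\<i> * of_real (real k * \<theta>)))" for k
    proof -
      have "exp (\<i> * of_real ((real k - 1) * \<theta>))
          = exp (- \<i> * of_real \<theta>) * exp (\<i> * of_real (real k * \<theta>))"
        unfolding exp_add[symmetric] by (simp add: algebra_simps)
      then show ?thesis by (simp only: h_def mult_ac)
    qed
    then show ?thesis by (simp add: V_def fourier_def sum_distrib_left)
  qed
  finally show ?thesis by (simp add: ir floquet_def)
qed (simp add: floquet_def)

text \<open>
  Averaged over the sampling angles, the energy and the norm of the transforms are those of \<open>x\<close>, while
  at each single angle the energy is a value of the form of the symbol.
\<close>

lemma stiffness_form_le:
  assumes M: "\<And>\<theta>. \<theta> \<in> {-pi..pi} \<Longrightarrow> lambda_max (symbol r \<xi> \<theta>) \<le> M" and n: "n > 0"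
  shows "Re (herm_form (stiffness n) x) \<le> M * norm2 (n * r - 1) x"
proof -
  define u where "u = extend0 (n * r) x"
  define V where "V j i = fourier n (dft_angle n j) (\<lambda>k. u (k * r + i))" for j i
  have energy: "(\<Sum>j<n. local_energy r \<xi> (V j)) = of_nat n * herm_form (stiffness n) x"
  proof -
    let ?a = "\<lambda>i j. complex_of_real (A_loc r \<xi> (Suc i) (Suc j))"
    have "(\<Sum>j<n. local_energy r \<xi> (V j))
        = (\<Sum>i\<le>r. \<Sum>i'\<le>r. \<Sum>j<n. ?a i i' * (cnj (V j i) * V j i'))"
      unfolding local_energy_def
      by (subst sum_swap_1_2, intro sum.cong refl) (simp only: mult_ac)
    also have "\<dots> = (\<Sum>i\<le>r. \<Sum>i'\<le>r. \<Sum>k<n. of_nat n * (cnj (u (k * r + i)) * ?a i i' * u (k * r + i')))"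
      unfolding sum_distrib_left[symmetric] V_def fourier_parseval
      by (simp add: sum_distrib_left mult_ac)
    also have "\<dots> = (\<Sum>k<n. \<Sum>i\<le>r. \<Sum>i'\<le>r. of_nat n * (cnj (u (k * r + i)) * ?a i i' * u (k * r + i')))"
      by (rule sum_swap_1_2[symmetric])
    also have "\<dots> = of_nat n * herm_form (stiffness n) x"
      unfolding herm_form_stiffness local_energy_def u_def by (simp only: sum_distrib_left)
    finally show ?thesis .
  qed
  have norm: "(\<Sum>j<n. norm2 r (V j)) = n * norm2 (n * r - 1) x"
  proof -
    have "complex_of_real (\<Sum>j<n. norm2 r (V j)) = (\<Sum>i<r. \<Sum>j<n. cnj (V j i) * V j i)"
      unfolding of_real_sum norm2_cnj by (rule sum.swap)
    also have "\<dots> = of_nat n * (\<Sum>i<r. \<Sum>k<n. cnj (u (k * r + i)) * u (k * r + i))"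
      unfolding V_def fourier_parseval by (simp add: sum_distrib_left)
    also have "(\<Sum>i<r. \<Sum>k<n. cnj (u (k * r + i)) * u (k * r + i))
        = complex_of_real (\<Sum>k<n. norm2 r (element_values r u k))"
      unfolding of_real_sum norm2_cnj by (rule sum.swap)
    also have "(\<Sum>k<n. norm2 r (element_values r u k)) = norm2 (n * r - 1) x"
      using norm2_by_elements[of n r x] n r by (simp add: u_def)
    finally have "complex_of_real (\<Sum>j<n. norm2 r (V j)) = of_real (n * norm2 (n * r - 1) x)"
      by simp
    then show ?thesis by (simp only: of_real_eq_iff)
  qed
  have "Re (local_energy r \<xi> (V j)) \<le> M * norm2 r (V j)" if j: "j < n" for j
  proof -
    let ?t = "dft_angle n j"
    have "local_energy r \<xi> (V j) = local_energy r \<xi> (floquet r ?t (V j))"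
      unfolding V_def by (intro local_energy_cong fourier_floquet) (simp_all add: u_def)
    also have "\<dots> = herm_form (symbol r \<xi> ?t) (V j)" using r by (simp add: herm_form_symbol)
    finally have "Re (local_energy r \<xi> (V j)) \<le> lambda_max (symbol r \<xi> ?t) * norm2 r (V j)"
      using lambda_max_hermitian(2)[OF symbol_carrier hermitian_symbol, of r \<xi> ?t "V j"] r by simp
    also have "\<dots> \<le> M * norm2 r (V j)"
      by (intro mult_right_mono M dft_angle_range j norm2_nonneg)
    finally show ?thesis .
  qed
  then have "(\<Sum>j<n. Re (local_energy r \<xi> (V j))) \<le> (\<Sum>j<n. M * norm2 r (V j))"
    by (intro sum_mono) auto
  also have "(\<Sum>j<n. Re (local_energy r \<xi> (V j))) = n * Re (herm_form (stiffness n) x)"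
    using arg_cong[OF energy, of Re] by simp
  also have "(\<Sum>j<n. M * norm2 r (V j)) = n * (M * norm2 (n * r - 1) x)"
    unfolding sum_distrib_left[symmetric] norm by simp
  finally show ?thesis using n by simp
qed

lemma lambda_max_stiffness_le:
  assumes "\<And>\<theta>. \<theta> \<in> {-pi..pi} \<Longrightarrow> lambda_max (symbol r \<xi> \<theta>) \<le> M" and n: "n * r \<ge> 2"
  shows "lambda_max (stiffness_matrix r \<xi> n) \<le> M"
proof -
  obtain x where x: "norm2 (n * r - 1) x > 0"
      "Re (herm_form (stiffness n) x) = lambda_max (stiffness_matrix r \<xi> n) * norm2 (n * r - 1) x"
    using stiffness_eigenvalues(3)[OF n] by blast
  have "n > 0" using n by (cases n) auto
  from stiffness_form_le[OF assms(1) this, of x] show ?thesis using x by simp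
qed

lemma stiffness_form_nonneg: "Re (herm_form (stiffness n) x) \<ge> 0"
  unfolding herm_form_stiffness by (simp add: sum_nonneg local_energy_nonneg)

text \<open>
  The test vector is the plane wave \<open>exp (-\<i>k\<theta>) * w i\<close> at node \<open>i\<close> of element \<open>k\<close>, cut off to zero at the
  ends of the mesh, with \<open>w\<close> a top eigenvector of the symbol. The cut changes only the two
  outermost elements, whose energy is still nonnegative.
\<close>

lemma lambda_max_stiffness_ge:
  assumes n: "n \<ge> 2"
  shows "(real n - 2) * lambda_max (symbol r \<xi> \<theta>) \<le> n * lambda_max (stiffness_matrix r \<xi> n)"
proof -
  have nr: "n * r \<ge> 2" using n r mult_le_mono[of 2 n 1 r] by simp
  define M where "M = lambda_max (symbol r \<xi> \<theta>)"
  have "eigenvalue (symbol r \<xi> \<theta>) (of_real M)"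
    unfolding M_def using r by (intro lambda_max_hermitian(1)[OF symbol_carrier hermitian_symbol]) simp
  then obtain v where v: "eigenvector (symbol r \<xi> \<theta>) v (of_real M)" by (auto simp: eigenvalue_def)
  define w where "w i = v $ i" for i
  have w: "norm2 r w > 0" "local_energy r \<xi> (floquet r \<theta> w) = of_real (M * norm2 r w)"
    using herm_form_eigen[OF symbol_carrier v] r by (simp_all add: w_def[abs_def] herm_form_symbol)
  define x where "x p = exp (\<i> * of_real (- real (Suc p div r) * \<theta>)) * w (Suc p mod r)" for p
  define u where "u = extend0 (n * r) x"
  have u: "u g = exp (\<i> * of_real (- real (g div r) * \<theta>)) * w (g mod r)" if "0 < g" "g < n * r" for g
    using that by (simp add: u_def extend0_def x_def)
  have inner: "Re (local_energy r \<xi> (element_values r u k)) = M * norm2 r w" if k: "k \<in> {1..<n-1}" for k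
  proof -
    define c where "c = exp (\<i> * of_real (- real k * \<theta>))"
    have "element_values r u k i = c * floquet r \<theta> w i" if i: "i \<le> r" for i
    proof -
      have "(k + 1) * r < n * r" using k r by (intro mult_strict_right_mono) auto
      then have g: "0 < k * r + i" "k * r + i < n * r" using k i r by auto
      show ?thesis
      proof (cases "i < r")
        case True
        then show ?thesis using u[OF g] by (simp add: c_def floquet_def)
      next
        case False
        then have ir: "i = r" using i by simp
        have "exp (\<i> * of_real (- real (k + 1) * \<theta>)) = c * exp (- \<i> * of_real \<theta>)"
          unfolding c_def exp_add[symmetric] by (simp add: algebra_simps)
        moreover have "(k * r + i) div r = k + 1" "(k * r + i) mod r = 0" using r by (simp_all add: ir)
        ultimately show ?thesis using u[OF g] by (simp add: floquet_def ir)
      qed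
    qed
    then have "local_energy r \<xi> (element_values r u k) = local_energy r \<xi> (\<lambda>i. c * floquet r \<theta> w i)"
      by (rule local_energy_cong)
    moreover have "cmod c = 1" unfolding c_def by (rule norm_exp_i_times)
    ultimately show ?thesis by (simp add: local_energy_scale w)
  qed
  have "(real n - 2) * (M * norm2 r w) = (\<Sum>k\<in>{1..<n-1}. Re (local_energy r \<xi> (element_values r u k)))"
    using n by (simp add: inner of_nat_diff)
  also have "\<dots> \<le> (\<Sum>k<n. Re (local_energy r \<xi> (element_values r u k)))"
    by (intro sum_mono2) (auto simp: local_energy_nonneg)
  also have "\<dots> = Re (herm_form (stiffness n) x)"
    by (simp add: herm_form_stiffness u_def)
  also have "\<dots> \<le> lambda_max (stiffness_matrix r \<xi> n) * norm2 (n * r - 1) x"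
    by (rule stiffness_eigenvalues(1)[OF nr])
  also have "\<dots> \<le> lambda_max (stiffness_matrix r \<xi> n) * (n * norm2 r w)"
  proof (rule mult_left_mono)
    have "norm2 (n * r - 1) x = (\<Sum>k<n. norm2 r (element_values r u k))"
      using norm2_by_elements[of n r x] n r by (simp add: u_def)
    also have "\<dots> \<le> (\<Sum>k<n. norm2 r w)"
      unfolding norm2_def
    proof (intro sum_mono power_mono)
      fix k i assume "i \<in> {..<r}"
      then have "(k * r + i) div r = k" "(k * r + i) mod r = i" by auto
      moreover have "cmod (u g) \<le> cmod (w (g mod r))" for g
      proof (cases "0 < g \<and> g < n * r")
        case True
        then show ?thesis by (simp only: u norm_mult norm_exp_i_times)
      next
        case False
        then have "u g = 0" by (auto simp: u_def extend0_def)
        then show ?thesis by simp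
      qed
      ultimately show "cmod (u (k * r + i)) \<le> cmod (w i)" by metis
    qed simp
    finally show "norm2 (n * r - 1) x \<le> n * norm2 r w" by simp
    obtain y where y: "norm2 (n * r - 1) y > 0"
        "Re (herm_form (stiffness n) y) = lambda_max (stiffness_matrix r \<xi> n) * norm2 (n * r - 1) y"
      using stiffness_eigenvalues(3)[OF nr] by blast
    then show "0 \<le> lambda_max (stiffness_matrix r \<xi> n)"
      using stiffness_form_nonneg[of n y] by (simp add: zero_le_mult_iff)
  qed
  finally have "((real n - 2) * M) * norm2 r w \<le> (n * lambda_max (stiffness_matrix r \<xi> n)) * norm2 r w"
    by (simp only: mult_ac)
  then show ?thesis using w(1) by (simp add: M_def)
qed

section \<open>The smallest eigenvalue\<close>

text \<open>
  Every nodal value is at most the sum of \<open>sqrt (E l)\<close> over the elements \<open>l\<close> up to its own, hence by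
  Cauchy-Schwarz its square is at most \<open>n\<close> times the total energy; there are at most \<open>n * r\<close> nodes.
\<close>

lemma discrete_poincare:
  assumes n: "n > 0"
  shows "norm2 (n * r - 1) x \<le> r * (real n)\<^sup>2 * Re (herm_form (stiffness n) x)"
proof -
  define u where "u = extend0 (n * r) x"
  define E where "E k = Re (local_energy r \<xi> (element_values r u k))" for k
  have E: "E k \<ge> 0" for k by (simp add: E_def local_energy_nonneg)
  have step: "cmod (u (k * r + i) - u (k * r)) \<le> sqrt (E k)" if "i \<le> r" for k i
    using local_energy_ge[OF that, of "element_values r u k"] by (simp add: E_def real_le_rsqrt)
  have node: "cmod (u (k * r)) \<le> (\<Sum>l<k. sqrt (E l))" for k
  proof (induction k)
    case (Suc k)
    have "cmod (u (Suc k * r)) \<le> cmod (u (k * r)) + cmod (u (k * r + r) - u (k * r))"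
      using norm_triangle_sub[of "u (k * r + r)" "u (k * r)"] by (simp add: add.commute)
    then show ?case using Suc step[of r k] by simp
  qed (simp add: u_def)
  have bound: "(cmod (u (k * r + i)))\<^sup>2 \<le> n * (\<Sum>l<n. E l)" if k: "k < n" and i: "i < r" for k i
  proof -
    have "cmod (u (k * r + i)) \<le> cmod (u (k * r)) + cmod (u (k * r + i) - u (k * r))"
      by (rule norm_triangle_sub)
    also have "\<dots> \<le> (\<Sum>l<Suc k. sqrt (E l))" using node[of k] step[of i k] i by simp
    also have "\<dots> \<le> (\<Sum>l<n. sqrt (E l))" using k E by (intro sum_mono2) auto
    finally have "(cmod (u (k * r + i)))\<^sup>2 \<le> (\<Sum>l<n. sqrt (E l))\<^sup>2" by (intro power_mono) auto
    also have "\<dots> \<le> (\<Sum>l<n. (sqrt (E l))\<^sup>2) * n"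
      using Cauchy_Schwarz_ineq_sum[of "\<lambda>l. sqrt (E l)" "\<lambda>_. 1" "{..<n}"] by simp
    finally show ?thesis using E by (simp add: mult.commute)
  qed
  have "norm2 (n * r - 1) x = (\<Sum>k<n. norm2 r (element_values r u k))"
    using norm2_by_elements[of n r x] n r by (simp add: u_def)
  also have "\<dots> \<le> (\<Sum>k<n. \<Sum>i<r. n * (\<Sum>l<n. E l))"
    unfolding norm2_def by (intro sum_mono bound) auto
  also have "\<dots> = r * (real n)\<^sup>2 * (\<Sum>l<n. E l)" by (simp add: power2_eq_square)
  also have "(\<Sum>l<n. E l) = Re (herm_form (stiffness n) x)"
    by (simp add: herm_form_stiffness E_def u_def)
  finally show ?thesis .
qed

lemma lambda_min_stiffness_ge:
  assumes n: "n * r \<ge> 2"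
  shows "(1 / r) / (real n)\<^sup>2 \<le> lambda_min (stiffness_matrix r \<xi> n)"
proof -
  obtain x where x: "norm2 (n * r - 1) x > 0"
      "Re (herm_form (stiffness n) x) = lambda_min (stiffness_matrix r \<xi> n) * norm2 (n * r - 1) x"
    using stiffness_eigenvalues(4)[OF n] by blast
  have npos: "n > 0" using n by (cases n) auto
  have "1 * norm2 (n * r - 1) x
      \<le> (r * (real n)\<^sup>2 * lambda_min (stiffness_matrix r \<xi> n)) * norm2 (n * r - 1) x"
    using discrete_poincare[OF npos, of x] x(2) by (simp add: mult.assoc)
  then have "1 \<le> r * (real n)\<^sup>2 * lambda_min (stiffness_matrix r \<xi> n)"
    using x(1) by (simp only: mult_le_cancel_right_pos)
  then show ?thesis using npos r by (simp add: field_simps)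
qed

text \<open>
  With \<open>sin\<^sup>2 t = 1/2 + cos (2 t - \<pi>) / 2\<close> the sum reduces to the orthogonality of the frequencies \<open>0\<close>
  and \<open>1\<close>.
\<close>

lemma sum_sin_squared:
  assumes "N \<ge> 2"
  shows "(\<Sum>g<N. (sin (pi * real g / real N))\<^sup>2) = real N / 2"
proof -
  have "(\<Sum>j<N. exp (\<i> * of_real (dft_angle N j))) = 0"
    using dft_orthogonality[of 1 N 0] assms by simp
  then have "Re (\<Sum>j<N. exp (\<i> * of_real (dft_angle N j))) = 0" by simp
  then have "(\<Sum>j<N. cos (dft_angle N j)) = 0" by (simp add: Re_exp)
  moreover have "(sin (pi * real g / real N))\<^sup>2 = 1 / 2 + cos (dft_angle N g) / 2" for g
    using cos_double_sin[of "pi * g / N"]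
    by (simp add: dft_angle_def cos_diff mult.assoc field_simps)
  ultimately show ?thesis by (simp add: sum.distrib flip: sum_divide_distrib)
qed

text \<open>
  The discrete sine \<open>sin (\<pi> g / N)\<close> at node \<open>g\<close> varies by at most \<open>\<pi> / n\<close> within an element, so its energy
  is of order \<open>1/n\<close>, whereas its squared norm is \<open>N / 2\<close>.
\<close>

lemma lambda_min_stiffness_le:
  assumes n: "n * r \<ge> 2"
  shows "lambda_min (stiffness_matrix r \<xi> n) \<le> (2 * energy_bound r \<xi> * pi\<^sup>2 / r) / (real n)\<^sup>2"
proof -
  define N where "N = n * r"
  have npos: "n > 0" using n by (cases n) auto
  define x where "x p = complex_of_real (sin (pi * real (Suc p) / real N))" for p
  define u where "u = extend0 N x"
  have u: "u g = of_real (sin (pi * real g / real N))" if "g \<le> N" for g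
    using that n by (cases "g = 0 \<or> g = N") (auto simp: u_def extend0_def x_def N_def)
  have energy: "Re (local_energy r \<xi> (element_values r u k)) \<le> energy_bound r \<xi> * (pi / n)\<^sup>2"
    if k: "k < n" for k
  proof (rule local_energy_le)
    fix i assume i: "i \<le> r"
    have "(k + 1) * r \<le> n * r" using k by (intro mult_le_mono) auto
    then have le: "k * r + i \<le> N" "k * r \<le> N" using i k by (auto simp: N_def)
    have lip: "\<bar>sin a - sin b\<bar> \<le> \<bar>a - b\<bar>" for a b :: real
    proof -
      have "\<bar>sin a - sin b\<bar> = 2 * \<bar>sin ((a - b) / 2)\<bar> * \<bar>cos ((a + b) / 2)\<bar>"
        by (simp add: sin_diff_sin abs_mult)
      also have "\<dots> \<le> 2 * \<bar>(a - b) / 2\<bar> * 1"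
        by (intro mult_mono abs_sin_x_le_abs_x abs_cos_le_one) auto
      finally show ?thesis by simp
    qed
    have "cmod (u (k * r + i) - u (k * r))
        = \<bar>sin (pi * real (k * r + i) / real N) - sin (pi * real (k * r) / real N)\<bar>"
      unfolding u[OF le(1)] u[OF le(2)] of_real_diff[symmetric] by (rule norm_of_real)
    also have "\<dots> \<le> \<bar>pi * real (k * r + i) / real N - pi * real (k * r) / real N\<bar>" by (rule lip)
    also have "\<dots> = pi * real i / real N"
      by (simp add: algebra_simps flip: diff_divide_distrib)
    also have "\<dots> \<le> pi * real r / real N" using i by (intro divide_right_mono mult_left_mono) auto
    also have "\<dots> = pi / n" using r by (simp add: N_def)
    finally show "cmod (element_values r u k i - element_values r u k 0) \<le> pi / n" by simp
  qed
  have "norm2 (N - 1) x = (\<Sum>g<N. (cmod (u g))\<^sup>2)"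
  proof -
    obtain m where m: "N = Suc m" using n by (cases N) (auto simp: N_def)
    show ?thesis unfolding m sum.lessThan_Suc_shift
      by (simp add: norm2_def u_def extend0_def m)
  qed
  also have "\<dots> = (\<Sum>g<N. (sin (pi * real g / real N))\<^sup>2)"
    by (intro sum.cong refl) (simp only: u less_imp_le lessThan_iff norm_of_real power2_abs)
  also have "\<dots> = real N / 2" using n by (intro sum_sin_squared) (simp add: N_def)
  finally have norm: "norm2 (N - 1) x = real N / 2" .
  have "lambda_min (stiffness_matrix r \<xi> n) * (real N / 2) \<le> Re (herm_form (stiffness n) x)"
    using stiffness_eigenvalues(2)[OF n, of x, folded N_def] by (simp only: norm)
  also have "\<dots> = (\<Sum>k<n. Re (local_energy r \<xi> (element_values r u k)))"
    by (simp add: herm_form_stiffness u_def N_def)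
  also have "\<dots> \<le> (\<Sum>k<n. energy_bound r \<xi> * (pi / n)\<^sup>2)" by (intro sum_mono energy) auto
  also have "\<dots> = energy_bound r \<xi> * pi\<^sup>2 / n" using npos by (simp add: power2_eq_square)
  finally show ?thesis using npos r by (simp add: N_def field_simps power2_eq_square)
qed

section \<open>The maximum over the symbol and the condition number\<close>

lemma continuous_lambda_max_symbol: "continuous_on S (\<lambda>\<theta>. lambda_max (symbol r \<xi> \<theta>))"
  unfolding continuous_on_def
proof
  fix t assume "t \<in> S"
  let ?F = "at t within S"
  define d where "d s = entry_sum (symbol r \<xi> s - symbol r \<xi> t)" for s
  have d: "d s = (\<Sum>i<r. \<Sum>j<r. cmod (symbol r \<xi> s $$ (i, j) - symbol r \<xi> t $$ (i, j)))" for s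
    using symbol_carrier[of r \<xi> s] symbol_carrier[of r \<xi> t] by (simp add: d_def entry_sum_def)
  have "((\<lambda>s. symbol r \<xi> s $$ (i, j)) \<longlongrightarrow> symbol r \<xi> t $$ (i, j)) ?F" if "i < r" "j < r" for i j
    unfolding symbol_entry[OF that] by (intro tendsto_intros)
  then have "(d \<longlongrightarrow> (\<Sum>i<r. \<Sum>j<r. cmod (symbol r \<xi> t $$ (i, j) - symbol r \<xi> t $$ (i, j)))) ?F"
    unfolding d by (intro tendsto_sum tendsto_norm tendsto_diff tendsto_const) auto
  then have lim: "(d \<longlongrightarrow> 0) ?F" by simp
  have le: "\<bar>lambda_max (symbol r \<xi> s) - lambda_max (symbol r \<xi> t)\<bar> \<le> d s" for s
  proof -
    have "entry_sum (symbol r \<xi> t - symbol r \<xi> s) = d s"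
      using symbol_carrier[of r \<xi> s] symbol_carrier[of r \<xi> t]
      by (simp add: d entry_sum_def norm_minus_commute)
    then show ?thesis
      using lambda_max_diff_le[OF symbol_carrier hermitian_symbol symbol_carrier hermitian_symbol, of r \<xi> s \<xi> t]
        lambda_max_diff_le[OF symbol_carrier hermitian_symbol symbol_carrier hermitian_symbol, of r \<xi> t \<xi> s] r
      by (auto simp: d_def)
  qed
  have "((\<lambda>s. lambda_max (symbol r \<xi> s) - lambda_max (symbol r \<xi> t)) \<longlongrightarrow> 0) ?F"
    by (rule Lim_null_comparison[OF always_eventually lim]) (simp only: real_norm_def le simp_thms)
  then show "((\<lambda>s. lambda_max (symbol r \<xi> s)) \<longlongrightarrow> lambda_max (symbol r \<xi> t)) ?F"
    by (simp add: LIM_zero_iff)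
qed

end

theorem mainTheorem3:
  fixes r :: nat and \<xi> :: "nat \<Rightarrow> real"
  assumes "r \<ge> 1"
    and "\<xi> ` {1..r+1} \<subseteq> {0..1}" and "inj_on \<xi> {1..r+1}"
    and "\<xi> 1 = 0" and "\<xi> (r+1) = 1"
  shows "(\<exists>c>0. \<exists>C>0. \<forall>\<^sub>F n in sequentially.
           c / (real n)^2 \<le> lambda_min (stiffness_matrix r \<xi> n) \<and>
           lambda_min (stiffness_matrix r \<xi> n) \<le> C / (real n)^2) \<and>
         (\<exists>\<theta>\<^sub>0\<in>{-pi..pi}.
           (\<forall>\<theta>\<in>{-pi..pi}. lambda_max (symbol r \<xi> \<theta>) \<le> lambda_max (symbol r \<xi> \<theta>\<^sub>0)) \<and>
           (\<lambda>n. lambda_max (stiffness_matrix r \<xi> n)) \<longlonglongrightarrow> lambda_max (symbol r \<xi> \<theta>\<^sub>0) \<and>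
           (\<forall>n. n * r \<ge> 2 \<longrightarrow>
             lambda_max (stiffness_matrix r \<xi> n) \<le> lambda_max (symbol r \<xi> \<theta>\<^sub>0))) \<and>
         (\<exists>c'>0. \<exists>C'>0. \<forall>\<^sub>F n in sequentially.
           c' * (real n)^2 \<le> kappa2 (stiffness_matrix r \<xi> n) \<and>
           kappa2 (stiffness_matrix r \<xi> n) \<le> C' * (real n)^2)"
proof -
  interpret element_nodes r \<xi> using assms by unfold_locales
  let ?min = "\<lambda>n. lambda_min (stiffness_matrix r \<xi> n)"
  let ?max = "\<lambda>n. lambda_max (stiffness_matrix r \<xi> n)"
  define c where "c = 1 / real r"
  \<comment> \<open>the summand 1 makes \<open>C\<close> positive without an argument that \<open>energy_bound r \<xi>\<close> is\<close>
  define C where "C = 2 * energy_bound r \<xi> * pi\<^sup>2 / r + 1"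
  have nr: "n * r \<ge> 2" if "n \<ge> 2" for n using that r mult_le_mono[of 2 n 1 r] by simp
  have c: "c > 0" using r by (simp add: c_def)
  have C: "C > 0" using energy_bound_nonneg[of r \<xi>] by (simp add: C_def add_nonneg_pos)
  have min: "c / (real n)\<^sup>2 \<le> ?min n" "?min n \<le> C / (real n)\<^sup>2" if n: "n \<ge> 2" for n
  proof -
    show "c / (real n)\<^sup>2 \<le> ?min n"
      using lambda_min_stiffness_ge[OF nr[OF n]] by (simp only: c_def)
    have "2 * energy_bound r \<xi> * pi\<^sup>2 / r / (real n)\<^sup>2 \<le> C / (real n)\<^sup>2"
      by (intro divide_right_mono) (simp_all add: C_def)
    then show "?min n \<le> C / (real n)\<^sup>2"
      using lambda_min_stiffness_le[OF nr[OF n]] by linarith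
  qed
  obtain \<theta>\<^sub>0 where \<theta>\<^sub>0: "\<theta>\<^sub>0 \<in> {-pi..pi}"
      "\<And>\<theta>. \<theta> \<in> {-pi..pi} \<Longrightarrow> lambda_max (symbol r \<xi> \<theta>) \<le> lambda_max (symbol r \<xi> \<theta>\<^sub>0)"
    using continuous_attains_sup[OF compact_Icc _ continuous_lambda_max_symbol, of "-pi" pi] by auto
  define M where "M = lambda_max (symbol r \<xi> \<theta>\<^sub>0)"
  have max_le: "?max n \<le> M" if "n * r \<ge> 2" for n
    unfolding M_def by (rule lambda_max_stiffness_le[OF \<theta>\<^sub>0(2) that])
  have max_ge: "M - 2 * M / real n \<le> ?max n" if n: "n \<ge> 2" for n
    using lambda_max_stiffness_ge[OF n, of \<theta>\<^sub>0] n by (simp add: M_def field_simps)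
  have lim: "?max \<longlonglongrightarrow> M"
  proof (rule tendsto_sandwich)
    show "\<forall>\<^sub>F n in sequentially. M - 2 * M / real n \<le> ?max n"
      using eventually_ge_at_top[of 2] by eventually_elim (rule max_ge)
    show "\<forall>\<^sub>F n in sequentially. ?max n \<le> M"
      using eventually_ge_at_top[of 2] by eventually_elim (rule max_le[OF nr])
    have "(\<lambda>n. M - 2 * M / real n) \<longlonglongrightarrow> M - 0"
      by (intro tendsto_diff tendsto_const lim_const_over_n)
    then show "(\<lambda>n. M - 2 * M / real n) \<longlonglongrightarrow> M" by simp
  qed simp
  \<comment> \<open>any one \<open>n\<close> gives \<open>0 < lambda_min \<le> lambda_max \<le> M\<close>; two elements suffice for a nonempty matrix\<close>
  have M: "M > 0"
  proof -
    obtain x where x: "norm2 (2 * r - 1) x > 0"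
        "Re (herm_form (stiffness 2) x) = ?min 2 * norm2 (2 * r - 1) x"
      using stiffness_eigenvalues(4)[of 2] r by auto
    have "?min 2 * norm2 (2 * r - 1) x \<le> ?max 2 * norm2 (2 * r - 1) x"
      using stiffness_eigenvalues(1)[of 2 x] r x(2) by simp
    then have "?min 2 \<le> ?max 2" using x(1) by simp
    moreover have "0 < c / (real 2)\<^sup>2" using c by simp
    ultimately show ?thesis using min(1)[of 2] max_le[OF nr, of 2] by linarith
  qed
  have "\<forall>\<^sub>F n in sequentially. ?max n > M / 2"
    using order_tendstoD(1)[OF lim, of "M / 2"] M by simp
  then have kappa: "\<forall>\<^sub>F n in sequentially. M / (2 * C) * (real n)\<^sup>2 \<le> kappa2 (stiffness_matrix r \<xi> n) \<and>
      kappa2 (stiffness_matrix r \<xi> n) \<le> M / c * (real n)\<^sup>2"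
    using eventually_ge_at_top[of 2]
  proof eventually_elim
    case (elim n)
    have n2: "(real n)\<^sup>2 > 0" using elim by simp
    have pos: "0 < c / (real n)\<^sup>2" using c n2 by simp
    have "M / (2 * C) * (real n)\<^sup>2 = (M / 2) / (C / (real n)\<^sup>2)" using C n2 by (simp add: field_simps)
    also have "\<dots> \<le> ?max n / ?min n"
      using elim min[of n] M pos by (intro frac_le) auto
    finally have 1: "M / (2 * C) * (real n)\<^sup>2 \<le> ?max n / ?min n" .
    have "?max n / ?min n \<le> M / (c / (real n)\<^sup>2)"
      using elim min[of n] M pos max_le[OF nr, of n] by (intro frac_le) auto
    also have "\<dots> = M / c * (real n)\<^sup>2" by simp
    finally show ?case using 1 by (simp add: kappa2_def)
  qed
  have "\<forall>\<^sub>F n in sequentially. c / (real n)\<^sup>2 \<le> ?min n \<and> ?min n \<le> C / (real n)\<^sup>2"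
    using eventually_ge_at_top[of 2] by eventually_elim (use min in blast)
  then have part1: "\<exists>c>0. \<exists>C>0. \<forall>\<^sub>F n in sequentially.
      c / (real n)\<^sup>2 \<le> ?min n \<and> ?min n \<le> C / (real n)\<^sup>2"
    using c C by blast
  have "M / (2 * C) > 0" "M / c > 0" using M c C by simp_all
  then have part3: "\<exists>c'>0. \<exists>C'>0. \<forall>\<^sub>F n in sequentially.
      c' * (real n)\<^sup>2 \<le> kappa2 (stiffness_matrix r \<xi> n) \<and>
      kappa2 (stiffness_matrix r \<xi> n) \<le> C' * (real n)\<^sup>2"
    using kappa by blast
  show ?thesis
    using part1 part3 \<theta>\<^sub>0 lim max_le unfolding M_def by blast
qed

end
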